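(* Let $J\in\mathbb C^{p\times p}$ be a signature matrix, let $\kappa\in\mathbb N_0$, let $\Theta\in\mathscr S_\kappa^J(\mathbb D)$, let $N\in\mathbb N$ and let $\Theta_N(z)=\Theta(z^N)$. For $j=0,\ldots,N-1$ let $S_j:\mathcal P(\Theta)\longrightarrow\mathcal P(\Theta_N)$ be the operator $$(S_jf)(z)=z^jf(z^N).$$ Then the adjoint $S_j^{[*]}:\mathcal P(\Theta_N)\longrightarrow\mathcal P(\Theta)$ is given by $$S_j^{[*]}f=f_j,$$ where $f(z)=\sum_{j=0}^{N-1}z^jf_j(z^N)$, with $f_0,\ldots,f_{N-1}\in\mathcal P(\Theta)$, is the unique representation of this form of $f\in\mathcal P(\Theta_N)$. Moreover $$S_j^{[*]}S_k=\delta_{j,k}I_{\mathcal P(\Theta)}\quad (j,k\in\{0,\ldots,N-1\}),\qquad \sum_{j=0}^{N-1}S_jS_j^{[*]}=I_{\mathcal P(\Theta_N)}.$$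
   Context: $\mathbb D$ is the open unit disk; $w^*$ denotes the complex conjugate of $w\in\mathbb C$. A signature matrix is a matrix $J$ with $J=J^{-1}=J^*$. A Krein space is a complex vector space $V$ with a Hermitian form $[\cdot,\cdot]$ admitting a decomposition $V=V_++V_-$, with $V_+\cap V_-=\{0\}$ and $[v_+,v_-]=0$ for $v_\pm\in V_\pm$, such that $(V_+,[\cdot,\cdot])$ and $(V_-,-[\cdot,\cdot])$ are Hilbert spaces; it is a Pontryagin space of (negative) index $\dim V_-$ if $\dim V_-<\infty$. Its topology is that of the Hilbert space with inner product $[v_+,w_+]-[v_-,w_-]$ (independent of the decomposition). For a bounded operator $A$ between Krein spaces $\mathcal K_1,\mathcal K_2$, $A^{[*]}$ is the adjoint with respect to the indefinite forms: $[Af_1,f_2]_2=[f_1,A^{[*]}f_2]_1$. A Hermitian matrix-valued kernel $K(z,w)$ on a set $\Omega$ ($K(z,w)^*=K(w,z)$) has $\kappa$ negative squares if every Hermitian block matrix $(K(w_\ell,w_j))_{\ell,j=1}^M$, $w_1,\ldots,w_M\in\Omega$, has at most $\kappa$ strictly negative eigenvalues, and exactly $\kappa$ for some choice of $M,w_1,\ldots,w_M$. Such a kernel is the reproducing kernel of a unique reproducing kernel Pontryagin space (of index $\kappa$) of vector-valued functions on $\Omega$, i.e. $K(\cdot,w)\xi$ belongs to the space and $[f,K(\cdot,w)\xi]=\xi^*f(w)$ for all $f$ in the space, $w\in\Omega$ and vectors $\xi$. $\mathscr S_\kappa^J(\mathbb D)$ is the family of $\mathbb C^{p\times p}$-valued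 functions $\Theta$ meromorphic in $\mathbb D$ such that the kernel $K_\Theta(z,w)=\frac{J-\Theta(z)J\Theta(w)^*}{1-zw^*}$ has $\kappa$ negative squares in the domain of analyticity of $\Theta$ in $\mathbb D$; $\mathcal P(\Theta)$ denotes the reproducing kernel Pontryagin space with reproducing kernel $K_\Theta$. The function $\Theta_N$ belongs to $\mathscr S^J_{N\kappa}(\mathbb D)$, and $\mathcal P(\Theta_N)$ denotes the space with reproducing kernel $K_{\Theta_N}$; it consists of the functions $\sum_{j=0}^{N-1}z^jf_j(z^N)$ with $f_j\in\mathcal P(\Theta)$, such a representation being unique. *)

theory Defs
  imports
    "HOL-Complex_Analysis.Complex_Analysis"
    "HOL-Library.Function_Algebras"
    "HOL-Library.FuncSet"
    "Jordan_Normal_Form.Char_Poly"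
begin

no_notation vec_index (infixl "$" 100)

section \<open>Krein and Pontryagin spaces\<close>

text \<open>
  Spaces are subspaces \<open>V\<close> of one ambient complex vector space.  Forms are linear in the first
  and conjugate-linear in the second argument; only their values on \<open>V\<close> matter.
\<close>

locale complex_vector_space = vector_space scale
  for scale :: "complex \<Rightarrow> 'v::ab_group_add \<Rightarrow> 'v"
begin

definition hermitian_form :: "'v set \<Rightarrow> ('v \<Rightarrow> 'v \<Rightarrow> complex) \<Rightarrow> bool" where
  "hermitian_form V B \<longleftrightarrow>
     (\<forall>x\<in>V. \<forall>y\<in>V. \<forall>z\<in>V. B (x + y) z = B x z + B y z) \<and>
     (\<forall>c. \<forall>x\<in>V. \<forall>y\<in>V. B (scale c x) y = c * B x y) \<and>
     (\<forall>x\<in>V. \<forall>y\<in>V. B y x = cnj (B x y))"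

definition hilbert_space :: "'v set \<Rightarrow> ('v \<Rightarrow> 'v \<Rightarrow> complex) \<Rightarrow> bool" where
  "hilbert_space V B \<longleftrightarrow>
     subspace V \<and> hermitian_form V B \<and>
     (\<forall>x\<in>V. x \<noteq> 0 \<longrightarrow> 0 < Re (B x x)) \<and>
     (\<forall>X. (\<forall>n::nat. X n \<in> V) \<and>
          (\<forall>e>0. \<exists>M. \<forall>m\<ge>M. \<forall>n\<ge>M. sqrt (Re (B (X m - X n) (X m - X n))) < e) \<longrightarrow>
          (\<exists>x\<in>V. (\<lambda>n. sqrt (Re (B (X n - x) (X n - x)))) \<longlonglongrightarrow> 0))"

definition fundamental_decomposition ::
  "'v set \<Rightarrow> ('v \<Rightarrow> 'v \<Rightarrow> complex) \<Rightarrow> 'v set \<Rightarrow> 'v set \<Rightarrow> bool" where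
  "fundamental_decomposition V B Vp Vm \<longleftrightarrow>
     V = {x + y | x y. x \<in> Vp \<and> y \<in> Vm} \<and> Vp \<inter> Vm = {0} \<and>
     (\<forall>x\<in>Vp. \<forall>y\<in>Vm. B x y = 0) \<and>
     hilbert_space Vp B \<and> hilbert_space Vm (\<lambda>x y. - B x y)"

text \<open>A finite basis is required explicitly since \<open>dim\<close> is \<open>0\<close> on infinite-dimensional spaces.\<close>

definition pontryagin_space :: "nat \<Rightarrow> 'v set \<Rightarrow> ('v \<Rightarrow> 'v \<Rightarrow> complex) \<Rightarrow> bool" where
  "pontryagin_space \<kappa> V B \<longleftrightarrow>
     subspace V \<and> hermitian_form V B \<and>
     (\<exists>Vp Vm. fundamental_decomposition V B Vp Vm \<and>
        (\<exists>b. finite b \<and> independent b \<and> span b = Vm \<and> card b = \<kappa>))"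

text \<open>The norm of the inner product \<open>[v\<^sub>+, w\<^sub>+] - [v\<^sub>-, w\<^sub>-]\<close>.\<close>

definition decomposition_norm ::
  "('v \<Rightarrow> 'v \<Rightarrow> complex) \<Rightarrow> 'v set \<Rightarrow> 'v set \<Rightarrow> 'v \<Rightarrow> real" where
  "decomposition_norm B Vp Vm x =
     (THE r. \<exists>xp\<in>Vp. \<exists>xm\<in>Vm. x = xp + xm \<and> r = sqrt (Re (B xp xp - B xm xm)))"

text \<open>
  Different fundamental decompositions of a Krein space give equivalent norms, so boundedness
  for one choice of decompositions is boundedness for all of them.
\<close>

definition bounded_operator ::
  "'v set \<Rightarrow> ('v \<Rightarrow> 'v \<Rightarrow> complex) \<Rightarrow> 'v set \<Rightarrow> ('v \<Rightarrow> 'v \<Rightarrow> complex) \<Rightarrow> ('v \<Rightarrow> 'v) \<Rightarrow> bool" where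
  "bounded_operator V1 B1 V2 B2 A \<longleftrightarrow>
     A \<in> V1 \<rightarrow> V2 \<and>
     (\<forall>x\<in>V1. \<forall>y\<in>V1. A (x + y) = A x + A y) \<and>
     (\<forall>c. \<forall>x\<in>V1. A (scale c x) = scale c (A x)) \<and>
     (\<exists>Vp Vm Wp Wm C.
        fundamental_decomposition V1 B1 Vp Vm \<and> fundamental_decomposition V2 B2 Wp Wm \<and>
        (\<forall>x\<in>V1. decomposition_norm B2 Wp Wm (A x) \<le> C * decomposition_norm B1 Vp Vm x))"

definition is_krein_adjoint ::
  "'v set \<Rightarrow> ('v \<Rightarrow> 'v \<Rightarrow> complex) \<Rightarrow> 'v set \<Rightarrow> ('v \<Rightarrow> 'v \<Rightarrow> complex) \<Rightarrow>
     ('v \<Rightarrow> 'v) \<Rightarrow> ('v \<Rightarrow> 'v) \<Rightarrow> bool" where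
  "is_krein_adjoint V1 B1 V2 B2 A T \<longleftrightarrow>
     T \<in> V2 \<rightarrow> V1 \<and> (\<forall>f1\<in>V1. \<forall>f2\<in>V2. B2 (A f1) f2 = B1 f1 (T f2))"

text \<open>The adjoint as an operator; its values outside \<open>V2\<close> are irrelevant.\<close>

definition krein_adjoint ::
  "'v set \<Rightarrow> ('v \<Rightarrow> 'v \<Rightarrow> complex) \<Rightarrow> 'v set \<Rightarrow> ('v \<Rightarrow> 'v \<Rightarrow> complex) \<Rightarrow>
     ('v \<Rightarrow> 'v) \<Rightarrow> 'v \<Rightarrow> 'v" where
  "krein_adjoint V1 B1 V2 B2 A f2 = (THE g. g \<in> V1 \<and> (\<forall>f1\<in>V1. B2 (A f1) f2 = B1 f1 g))"

end

section \<open>Vector-valued functions and reproducing kernels\<close>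

definition vfun_scale :: "complex \<Rightarrow> (complex \<Rightarrow> complex^'p) \<Rightarrow> complex \<Rightarrow> complex^'p" where
  "vfun_scale c f = (\<lambda>z. c *s f z)"

global_interpretation vfun: complex_vector_space vfun_scale
  by unfold_locales
    (auto simp: vfun_scale_def fun_eq_iff vector_add_ldistrib vector_sadd_rdistrib vector_smult_assoc)

definition conj_transpose :: "complex^'n^'m \<Rightarrow> complex^'m^'n" where
  "conj_transpose A = (\<chi> i j. cnj (A $ j $ i))"

definition signature_matrix :: "complex^'p^'p \<Rightarrow> bool" where
  "signature_matrix J \<longleftrightarrow> J ** J = Finite_Cartesian_Product.mat 1 \<and> conj_transpose J = J"

text \<open>
  The block matrix \<open>(K (w \<ell>) (w j))\<close>, \<open>\<ell>, j < M\<close>, as a square matrix of size \<open>M * p\<close>.  The rows and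
  columns of the blocks are listed by some enumeration of the index type \<open>'p\<close>; another
  enumeration gives a similar matrix.
\<close>

definition block_matrix ::
  "(complex \<Rightarrow> complex \<Rightarrow> complex^'p^'p) \<Rightarrow> nat \<Rightarrow> (nat \<Rightarrow> complex) \<Rightarrow> complex Matrix.mat" where
  "block_matrix K M w =
     (let p = CARD('p); e = from_nat_into (UNIV :: 'p set) in
      Matrix.mat (M * p) (M * p)
        (\<lambda>(a, b). K (w (a div p)) (w (b div p)) $ e (a mod p) $ e (b mod p)))"

text \<open>Negative eigenvalues are counted with multiplicity.\<close>

definition num_neg_eigenvalues :: "complex Matrix.mat \<Rightarrow> nat" where
  "num_neg_eigenvalues A = size {#l \<in># proots (char_poly A). l \<in> \<real> \<and> Re l < 0#}"

definition has_negative_squares ::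
  "complex set \<Rightarrow> (complex \<Rightarrow> complex \<Rightarrow> complex^'p^'p) \<Rightarrow> nat \<Rightarrow> bool" where
  "has_negative_squares \<Omega> K \<kappa> \<longleftrightarrow>
     (\<forall>z\<in>\<Omega>. \<forall>w\<in>\<Omega>. conj_transpose (K z w) = K w z) \<and>
     (\<forall>M w. (\<forall>l<M. w l \<in> \<Omega>) \<longrightarrow> num_neg_eigenvalues (block_matrix K M w) \<le> \<kappa>) \<and>
     (\<exists>M w. 0 < M \<and> (\<forall>l<M. w l \<in> \<Omega>) \<and> num_neg_eigenvalues (block_matrix K M w) = \<kappa>)"

text \<open>
  A function on \<open>\<Omega>\<close> is represented by the total function that vanishes outside \<open>\<Omega>\<close>, so that
  equality and the linear operations on functions on \<open>\<Omega>\<close> are those of total functions.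
\<close>

definition kernel_section ::
  "complex set \<Rightarrow> (complex \<Rightarrow> complex \<Rightarrow> complex^'p^'p) \<Rightarrow> complex \<Rightarrow> complex^'p \<Rightarrow>
     complex \<Rightarrow> complex^'p" where
  "kernel_section \<Omega> K w \<xi> = (\<lambda>z. if z \<in> \<Omega> then K z w *v \<xi> else 0)"

definition rk_pontryagin_space ::
  "complex set \<Rightarrow> (complex \<Rightarrow> complex \<Rightarrow> complex^'p^'p) \<Rightarrow>
     (complex \<Rightarrow> complex^'p) set \<Rightarrow>
     ((complex \<Rightarrow> complex^'p) \<Rightarrow> (complex \<Rightarrow> complex^'p) \<Rightarrow> complex) \<Rightarrow> bool" where
  "rk_pontryagin_space \<Omega> K V B \<longleftrightarrow>
     (\<exists>\<kappa>. vfun.pontryagin_space \<kappa> V B) \<and>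
     (\<forall>f\<in>V. \<forall>z. z \<notin> \<Omega> \<longrightarrow> f z = 0) \<and>
     (\<forall>w\<in>\<Omega>. \<forall>\<xi>. kernel_section \<Omega> K w \<xi> \<in> V \<and>
        (\<forall>f\<in>V. B f (kernel_section \<Omega> K w \<xi>) = (\<Sum>i\<in>UNIV. cnj (\<xi> $ i) * f w $ i)))"

section \<open>Generalized Schur functions\<close>

definition schur_kernel ::
  "complex^'p^'p \<Rightarrow> (complex \<Rightarrow> complex^'p^'p) \<Rightarrow> complex \<Rightarrow> complex \<Rightarrow> complex^'p^'p" where
  "schur_kernel J \<Theta> z w =
     (\<chi> i j. (J - \<Theta> z ** J ** conj_transpose (\<Theta> w)) $ i $ j / (1 - z * cnj w))"

definition analyticity_domain :: "(complex \<Rightarrow> complex^'p^'p) \<Rightarrow> complex set" where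
  "analyticity_domain \<Theta> = {z \<in> ball 0 1. \<forall>i j. (\<lambda>w. \<Theta> w $ i $ j) analytic_on {z}}"

text \<open>
  A meromorphic function is represented by its canonical total version, in which removable
  singularities are removed and each entry is \<open>0\<close> at its poles; the values at poles are never used,
  and the analyticity domain is the unit disk without the poles of the entries.
\<close>

definition gen_schur_class :: "nat \<Rightarrow> complex^'p^'p \<Rightarrow> (complex \<Rightarrow> complex^'p^'p) set" where
  "gen_schur_class \<kappa> J =
     {\<Theta>. (\<forall>i j. (\<lambda>z. \<Theta> z $ i $ j) nicely_meromorphic_on ball 0 1) \<and>
          has_negative_squares (analyticity_domain \<Theta>) (schur_kernel J \<Theta>) \<kappa>}"

text \<open>
  \<open>(V, B)\<close> is the space $\mathcal{P}(\Theta)$.  The kernel determines \<open>V\<close> and \<open>B\<close> on \<open>V\<close>,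
  hence also the index.
\<close>

definition is_P_space ::
  "complex^'p^'p \<Rightarrow> (complex \<Rightarrow> complex^'p^'p) \<Rightarrow> (complex \<Rightarrow> complex^'p) set \<Rightarrow>
     ((complex \<Rightarrow> complex^'p) \<Rightarrow> (complex \<Rightarrow> complex^'p) \<Rightarrow> complex) \<Rightarrow> bool" where
  "is_P_space J \<Theta> V B \<longleftrightarrow> rk_pontryagin_space (analyticity_domain \<Theta>) (schur_kernel J \<Theta>) V B"

text \<open>
  For \<open>N > 0\<close> this maps functions vanishing outside the analyticity domain of \<open>\<Theta>\<close> to functions
  vanishing outside that of \<open>\<lambda>z. \<Theta> (z ^ N)\<close>.
\<close>

definition S_op :: "nat \<Rightarrow> nat \<Rightarrow> (complex \<Rightarrow> complex^'p) \<Rightarrow> complex \<Rightarrow> complex^'p" where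
  "S_op N j f = (\<lambda>z. z ^ j *s f (z ^ N))"

end

theory Submission
  imports Defs
begin

text \<open>
  The kernels satisfy
  $K_{\Theta_N}(z,w) = \sum_{j<N} z^j \overline{w}^j K_\Theta(z^N,w^N)$, so the space
  $W$ of the functions $\sum_{j<N} z^j f_j(z^N)$ with the form
  $[f,g]_W = \sum_{j<N} [f_j,g_j]$ is a reproducing kernel Pontryagin space for
  $K_{\Theta_N}$, and $W = \mathcal{P}(\Theta_N)$ by uniqueness; all assertions can then be read
  off from the orthogonal sum.

  Uniqueness rests on one estimate.  In a Pontryagin space, the Hilbert norm differs from the
  indefinite square by finitely many squares $|[x,h_i]|^2$ with $h_i$ in the negative part.  Moving
  each $h_i$ slightly to a finite combination $e_i$ of kernel sections gives
  $\|x\|^2 \le 2[x,x] + 8\sum_i |[x,e_i]|^2$, whose right-hand side is intrinsic to the kernel.  The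
  same estimate shows that the elements of $\mathcal{P}(\Theta)$ are continuous at $0$, which makes
  the components $f_j$ unique there: at $z = 0$ only $f_0$ is visible in the sum.
\<close>

text \<open>A space is given only through the existence of some fundamental decomposition. Two
  spaces with one kernel may therefore carry unrelated Hilbert norms, and since the indefinite
  square of a difference does not measure its size, limits in the two spaces cannot be compared
  before the norms are. Finiteness of the negative part repairs this: replacing every h_i by a
  nearby e_i costs a multiple of the squared norm of x, and as there are finitely many i the total
  can be kept below half of the left-hand side. Absorbing it doubles the rest, which gives the
  factor 2 of [x,x]; the factor 8 is the weight 2 in the majorant, the 2 from bounding the square of
  a sum of two terms, and this doubling.

  For v \<noteq> 0 the N distinct solutions of z^N = v determine all components at v. The point 0
  has only itself as a root, and no power series is at hand there: the elements of the space are
  just functions with the reproducing property, so their continuity has to come from the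
  kernel.\<close>

no_notation fps_nth (infixl "$" 75)

section \<open>Inner product spaces on subspaces\<close>

locale hermitian_space = complex_vector_space scale
  for scale :: "complex \<Rightarrow> 'v::ab_group_add \<Rightarrow> 'v" +
  fixes V :: "'v set" and B :: "'v \<Rightarrow> 'v \<Rightarrow> complex"
  assumes subspace_V: "subspace V" and hermitian: "hermitian_form V B"
begin

lemma V_zero: "0 \<in> V"
  and V_add: "x \<in> V \<Longrightarrow> y \<in> V \<Longrightarrow> x + y \<in> V"
  and V_diff: "x \<in> V \<Longrightarrow> y \<in> V \<Longrightarrow> x - y \<in> V"
  and V_scale: "x \<in> V \<Longrightarrow> scale c x \<in> V"
  and V_sum: "(\<And>i. i \<in> I \<Longrightarrow> g i \<in> V) \<Longrightarrow> sum g I \<in> V"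
  using subspace_V by (auto intro: subspace_0 subspace_add subspace_diff subspace_scale subspace_sum)

lemma add_left: "x \<in> V \<Longrightarrow> y \<in> V \<Longrightarrow> z \<in> V \<Longrightarrow> B (x + y) z = B x z + B y z"
  and scale_left: "x \<in> V \<Longrightarrow> y \<in> V \<Longrightarrow> B (scale c x) y = c * B x y"
  and sym: "x \<in> V \<Longrightarrow> y \<in> V \<Longrightarrow> B y x = cnj (B x y)"
  using hermitian unfolding hermitian_form_def by blast+

lemma add_right: "x \<in> V \<Longrightarrow> y \<in> V \<Longrightarrow> z \<in> V \<Longrightarrow> B z (x + y) = B z x + B z y"
  using add_left[of x y z] sym V_add by (metis complex_cnj_add)

lemma scale_right: "x \<in> V \<Longrightarrow> y \<in> V \<Longrightarrow> B y (scale c x) = cnj c * B y x"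
  using scale_left[of x y c] sym V_scale by (metis complex_cnj_mult)

lemma diff_left: "x \<in> V \<Longrightarrow> y \<in> V \<Longrightarrow> z \<in> V \<Longrightarrow> B (x - y) z = B x z - B y z"
  using add_left[of "x - y" y z] V_diff by (simp add: algebra_simps)

lemma diff_right: "x \<in> V \<Longrightarrow> y \<in> V \<Longrightarrow> z \<in> V \<Longrightarrow> B z (x - y) = B z x - B z y"
  using add_right[of "x - y" y z] V_diff by (simp add: algebra_simps)

lemma zero_left: "x \<in> V \<Longrightarrow> B 0 x = 0"
  using diff_left[of x x x] by simp

lemma zero_right: "x \<in> V \<Longrightarrow> B x 0 = 0"
  using diff_right[of x x x] by simp

lemma sum_left: "(\<And>i. i \<in> I \<Longrightarrow> g i \<in> V) \<Longrightarrow> x \<in> V \<Longrightarrow> B (sum g I) x = (\<Sum>i\<in>I. B (g i) x)"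
proof (induction I rule: infinite_finite_induct)
  case (insert i I)
  then show ?case using add_left[of "g i" "sum g I" x] by (simp add: V_sum)
qed (auto simp: zero_left)

lemma sum_right: "(\<And>i. i \<in> I \<Longrightarrow> g i \<in> V) \<Longrightarrow> x \<in> V \<Longrightarrow> B x (sum g I) = (\<Sum>i\<in>I. B x (g i))"
proof (induction I rule: infinite_finite_induct)
  case (insert i I)
  then show ?case using add_right[of "g i" "sum g I" x] by (simp add: V_sum)
qed (auto simp: zero_right)

lemma diag_real: "x \<in> V \<Longrightarrow> B x x = of_real (Re (B x x))"
  using sym[of x x] by (metis Reals_cnj_iff complex_is_Real_iff of_real_Re)

lemmas form_simps = add_left add_right diff_left diff_right scale_left scale_right
  V_add V_diff V_scale

end

locale inner_space = hermitian_space +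
  assumes pos: "x \<in> V \<Longrightarrow> x \<noteq> 0 \<Longrightarrow> 0 < Re (B x x)"
begin

definition nrm :: "'a \<Rightarrow> real" where "nrm x = sqrt (Re (B x x))"

lemma Re_nonneg: "x \<in> V \<Longrightarrow> 0 \<le> Re (B x x)"
  using pos[of x] zero_left[OF V_zero] by (cases "x = 0") auto

lemma nrm_nonneg: "x \<in> V \<Longrightarrow> 0 \<le> nrm x"
  using Re_nonneg by (simp add: nrm_def)

lemma nrm_sq: "x \<in> V \<Longrightarrow> (nrm x)\<^sup>2 = Re (B x x)"
  using Re_nonneg by (simp add: nrm_def)

lemma nrm_zero: "nrm 0 = 0"
  by (simp add: nrm_def zero_left[OF V_zero])

lemma nrm_eq_0: "x \<in> V \<Longrightarrow> nrm x = 0 \<longleftrightarrow> x = 0"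
  using pos[of x] nrm_zero zero_left[OF V_zero] by (cases "x = 0") (auto simp: nrm_def)

lemma q_add:
  assumes "x \<in> V" "y \<in> V"
  shows "Re (B (x + y) (x + y)) = Re (B x x) + 2 * Re (B x y) + Re (B y y)"
  using assms sym[of x y] by (simp add: form_simps)

lemma q_diff:
  assumes "x \<in> V" "y \<in> V"
  shows "Re (B (x - y) (x - y)) = Re (B x x) - 2 * Re (B x y) + Re (B y y)"
  using assms sym[of x y] by (simp add: form_simps)

text \<open>The vector is the component of x orthogonal to y. That its square is nonnegative is the
  Cauchy-Schwarz inequality; that it drops by a definite amount unless \<open>B x y = 0\<close>
  forces vectors of minimal length to be orthogonal.\<close>

lemma q_residual:
  assumes x: "x \<in> V" and y: "y \<in> V" "y \<noteq> 0"
  defines "r \<equiv> Re (B y y)"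
  shows "Re (B (x - scale (B x y / of_real r) y) (x - scale (B x y / of_real r) y)) =
    Re (B x x) - (cmod (B x y))\<^sup>2 / r"
proof -
  have r: "0 < r" "B y y = of_real r" using pos[OF y] diag_real[OF y(1)] by (auto simp: r_def)
  define c where "c = B x y / of_real r"
  have "Re (B (x - scale c y) (x - scale c y)) =
      Re (B x x) - 2 * Re (cnj c * B x y) + Re (c * cnj c * B y y)"
    using x y by (subst q_diff) (auto simp: V_scale scale_left scale_right algebra_simps)
  also have "cnj c * B x y = of_real ((cmod (B x y))\<^sup>2 / r)"
    unfolding c_def of_real_divide complex_norm_square by (simp add: mult.commute)
  also have "c * cnj c * B y y = of_real ((cmod (B x y))\<^sup>2 / r)"
    unfolding c_def r(2) of_real_divide complex_norm_square using r(1) by simp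
  finally show ?thesis by (simp add: c_def)
qed

lemma Cauchy_Schwarz:
  assumes x: "x \<in> V" and y: "y \<in> V"
  shows "cmod (B x y) \<le> nrm x * nrm y"
proof (cases "y = 0")
  case True
  then show ?thesis using zero_right[OF x] by (simp add: nrm_zero)
next
  case False
  have "0 \<le> Re (B x x) - (cmod (B x y))\<^sup>2 / Re (B y y)"
    unfolding q_residual[OF x y False, symmetric] using x y by (intro Re_nonneg V_diff V_scale)
  then have "(cmod (B x y))\<^sup>2 \<le> (nrm x * nrm y)\<^sup>2"
    using pos[OF y False] x y by (simp add: nrm_sq power_mult_distrib field_simps)
  then show ?thesis
    using power2_le_imp_le nrm_nonneg[OF x] nrm_nonneg[OF y] by (metis mult_nonneg_nonneg)
qed

lemma nrm_triangle:
  assumes x: "x \<in> V" and y: "y \<in> V"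
  shows "nrm (x + y) \<le> nrm x + nrm y"
proof -
  have "Re (B x y) \<le> nrm x * nrm y"
    using Cauchy_Schwarz[OF x y] complex_Re_le_cmod order_trans by blast
  then have "(nrm (x + y))\<^sup>2 \<le> (nrm x + nrm y)\<^sup>2"
    using x y by (simp add: nrm_sq V_add q_add power2_sum)
  then show ?thesis using power2_le_imp_le nrm_nonneg x y by (metis add_nonneg_nonneg)
qed

lemma nrm_minus_commute: "x \<in> V \<Longrightarrow> y \<in> V \<Longrightarrow> nrm (x - y) = nrm (y - x)"
  by (simp add: nrm_def form_simps algebra_simps)

lemma nrm_triangle_diff:
  assumes "x \<in> V" "y \<in> V" "z \<in> V"
  shows "nrm (x - z) \<le> nrm (x - y) + nrm (y - z)"
  using nrm_triangle[of "x - y" "y - z"] assms by (simp add: V_diff)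

end

section \<open>Projection and density in Hilbert spaces\<close>

locale complete_inner_space = inner_space +
  assumes complete: "(\<And>n::nat. X n \<in> V) \<Longrightarrow>
    (\<And>e. 0 < e \<Longrightarrow> \<exists>M. \<forall>m\<ge>M. \<forall>n\<ge>M. nrm (X m - X n) < e) \<Longrightarrow>
    \<exists>x\<in>V. (\<lambda>n. nrm (X n - x)) \<longlonglongrightarrow> 0"
begin

text \<open>The projection argument: a sequence in D minimising the distance to f is Cauchy by the
  parallelogram law, and f minus its limit is orthogonal to D, hence 0. The limit x is only known to
  lie in V, so minimality is carried by \<open>g = f - x\<close>, tested against the shifts
  \<open>g - u\<close> with u in D.\<close>

lemma dense_if_trivial_complement:
  assumes D: "subspace D" "D \<subseteq> V"
    and triv: "\<And>g. g \<in> V \<Longrightarrow> (\<And>d. d \<in> D \<Longrightarrow> B g d = 0) \<Longrightarrow> g = 0"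
    and f: "f \<in> V" and e: "0 < e"
  shows "\<exists>d\<in>D. nrm (f - d) < e"
proof -
  let ?q = "\<lambda>x. Re (B x x)"
  define S where "S = (\<lambda>d. ?q (f - d)) ` D"
  define \<delta> where "\<delta> = Inf S"
  have S0: "S \<noteq> {}" using subspace_0[OF D(1)] by (auto simp: S_def)
  have DV: "d \<in> V" if "d \<in> D" for d using that D by auto
  have bdd: "bdd_below S"
    by (rule bdd_belowI[of _ 0]) (use DV f in \<open>auto simp: S_def V_diff intro!: Re_nonneg\<close>)
  have le: "\<delta> \<le> ?q (f - d)" if "d \<in> D" for d
    using cInf_lower[OF _ bdd] that by (auto simp: \<delta>_def S_def)
  have "\<exists>d\<in>D. ?q (f - d) < \<delta> + 1 / Suc n" for n
    using cInf_lessD[OF S0, of "\<delta> + 1 / Suc n"] by (auto simp: \<delta>_def S_def)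
  then obtain d where d: "\<And>n. d n \<in> D" "\<And>n. ?q (f - d n) < \<delta> + 1 / Suc n"
    by metis
  have dV: "d n \<in> V" for n using d DV by auto
  \<comment> \<open>Parallelogram law for \<open>f - d m\<close> and \<open>f - d n\<close>: their
    sum is twice \<open>f - h\<close> with the midpoint h in D, whose square is at least
    \<delta>.\<close>
  have par: "?q (d m - d n) \<le> 2 / Suc m + 2 / Suc n" for m n
  proof -
    define h where "h = scale (1/2) (d m + d n)"
    have hD: "h \<in> D" unfolding h_def using d D by (simp add: subspace_add subspace_scale)
    have eq: "f - d m + (f - d n) = scale 2 (f - h)"
      unfolding h_def by (simp add: scale_right_diff_distrib)
        (simp add: scale_left_distrib[of 1 1, simplified])
    have "4 * ?q (f - h) = ?q (scale 2 (f - h))"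
      using hD DV f by (simp add: form_simps)
    also have "\<dots> = ?q (f - d m) + 2 * Re (B (f - d m) (f - d n)) + ?q (f - d n)"
      unfolding eq[symmetric] by (rule q_add) (use f dV in \<open>auto simp: V_diff\<close>)
    finally have 1: "4 * ?q (f - h) = ?q (f - d m) + 2 * Re (B (f - d m) (f - d n)) + ?q (f - d n)" .
    have "?q (d m - d n) = ?q ((f - d n) - (f - d m))" by simp
    also have "\<dots> = ?q (f - d m) - 2 * Re (B (f - d m) (f - d n)) + ?q (f - d n)"
      by (subst q_diff) (use f dV sym[of "f - d m" "f - d n"] in \<open>auto simp: V_diff\<close>)
    finally have "?q (d m - d n) = 2 * ?q (f - d m) + 2 * ?q (f - d n) - 4 * ?q (f - h)"
      using 1 by simp
    then have "?q (d m - d n) \<le> 2 * (1 / Suc m) + 2 * (1 / Suc n)"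
      using le[OF hD] d(2)[of m] d(2)[of n] by linarith
    then show ?thesis by simp
  qed
  have "\<exists>M. \<forall>m\<ge>M. \<forall>n\<ge>M. nrm (d m - d n) < e'" if e': "0 < e'" for e'
  proof -
    obtain M where M: "4 / e'\<^sup>2 < real M" using reals_Archimedean2 by blast
    have "nrm (d m - d n) < e'" if "m \<ge> M" "n \<ge> M" for m n
    proof -
      have M0: "0 < real M" using M e' by (smt (verit) divide_nonneg_nonneg zero_le_power2)
      have "2 / Suc m + 2 / Suc n \<le> 2 / real M + 2 / real M"
        by (intro add_mono divide_left_mono) (use that M0 in auto)
      also have "\<dots> < e'\<^sup>2" using M M0 e' by (simp add: field_simps)
      finally have "(nrm (d m - d n))\<^sup>2 < e'\<^sup>2" using par[of m n] dV by (simp add: nrm_sq V_diff)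
      then show ?thesis using e' by (simp add: power2_less_imp_less)
    qed
    then show ?thesis by blast
  qed
  from complete[OF dV this] obtain x where x: "x \<in> V" "(\<lambda>n. nrm (d n - x)) \<longlonglongrightarrow> 0" by blast
  \<comment> \<open>The choice u = 0 bounds the square of g above by \<delta>, and u in D carries
    the lower bound at \<open>d n + u\<close> over to \<open>g - u\<close>.\<close>
  have lim: "(\<lambda>n. nrm (f - d n - u)) \<longlonglongrightarrow> nrm (f - x - u)" if u: "u \<in> V" for u
  proof (rule Lim_transform2[OF _ Lim_null_comparison[OF _ x(2)], of "\<lambda>_. nrm (f - x - u)"])
    show "\<forall>\<^sub>F n in sequentially. norm (nrm (f - x - u) - nrm (f - d n - u)) \<le> nrm (d n - x)"
    proof (rule always_eventually, rule allI)
      fix n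
      have comm: "f - v - u = f - u - v" for v by (simp add: algebra_simps)
      have "nrm (f - x - u) \<le> nrm (f - d n - u) + nrm (d n - x)"
        using nrm_triangle_diff[of "f - u" "d n" x] f x u dV by (simp add: V_diff comm[of x] comm[of "d n"])
      moreover have "nrm (f - d n - u) \<le> nrm (f - x - u) + nrm (x - d n)"
        using nrm_triangle_diff[of "f - u" x "d n"] f x u dV by (simp add: V_diff comm[of x] comm[of "d n"])
      ultimately show "norm (nrm (f - x - u) - nrm (f - d n - u)) \<le> nrm (d n - x)"
        using nrm_minus_commute[OF x(1) dV[of n]] by simp
    qed
  qed auto
  define g where "g = f - x"
  have gV: "g \<in> V" using f x by (simp add: g_def V_diff)
  have "(\<lambda>n. (nrm (f - d n))\<^sup>2) \<longlonglongrightarrow> (nrm g)\<^sup>2"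
    using tendsto_power[OF lim[OF V_zero], of 2] by (simp add: g_def)
  moreover have "(\<lambda>n. \<delta> + 1 / Suc n) \<longlonglongrightarrow> \<delta> + 0"
    by (intro tendsto_intros LIMSEQ_Suc[OF lim_1_over_n])
  ultimately have g\<delta>: "?q g \<le> \<delta>"
    using LIMSEQ_le[of "\<lambda>n. (nrm (f - d n))\<^sup>2" "(nrm g)\<^sup>2" "\<lambda>n. \<delta> + 1 / Suc n" \<delta>] d(2) dV f gV
    by (auto simp: nrm_sq V_diff intro: less_imp_le)
  have ge: "\<delta> \<le> ?q (g - u)" if u: "u \<in> D" for u
  proof -
    have "(\<lambda>n. (nrm (f - d n - u))\<^sup>2) \<longlonglongrightarrow> (nrm (g - u))\<^sup>2"
      using tendsto_power[OF lim, of u 2] DV u by (simp add: g_def)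
    moreover have "\<delta> \<le> (nrm (f - d n - u))\<^sup>2" for n
      using le[of "d n + u"] d u D(1) f dV DV by (simp add: nrm_sq V_diff subspace_add diff_diff_eq)
    ultimately have "\<delta> \<le> (nrm (g - u))\<^sup>2"
      using LIMSEQ_le_const by blast
    then show ?thesis using gV u DV by (simp add: nrm_sq V_diff)
  qed
  have "B g u = 0" if u: "u \<in> D" for u
  proof (cases "u = 0")
    case True
    then show ?thesis using zero_right gV by simp
  next
    case False
    have uV: "u \<in> V" using u DV by auto
    have le_scale: "?q g \<le> ?q (g - scale c u)" for c
      using g\<delta> ge[of "scale c u"] u D(1) by (simp add: subspace_scale)
    \<comment> \<open>The left-hand side is the amount by which removing the component along u would
      shorten g, whose square is already minimal.\<close>
    have "(cmod (B g u))\<^sup>2 / Re (B u u) \<le> 0"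
      using le_scale[of "B g u / of_real (Re (B u u))"] unfolding q_residual[OF gV uV False] by simp
    then show ?thesis using pos[OF uV False] by (simp add: divide_le_0_iff)
  qed
  then have "g = 0" using triv[OF gV] by blast
  then have "(\<lambda>n. nrm (f - d n)) \<longlonglongrightarrow> 0" using lim[OF V_zero] by (simp add: g_def nrm_zero)
  then have "\<forall>\<^sub>F n in sequentially. nrm (f - d n) < e" using e order_tendstoD by blast
  then show ?thesis using d(1) eventually_happens by force
qed

end

section \<open>Hilbert majorants of Pontryagin spaces\<close>

lemma (in complex_vector_space) hilbert_space_imp_complete_inner_space:
  assumes "hilbert_space V B"
  shows "complete_inner_space scale V B"
proof -
  interpret inner_space scale V B
    using assms by unfold_locales (auto simp: hilbert_space_def)
  show ?thesis
    by unfold_locales (use assms in \<open>auto simp: hilbert_space_def nrm_def\<close>)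
qed

text \<open>Gram-Schmidt, by induction on b. A vector of b already in the span of the others
  contributes no h, so the family is indexed by its own length n. Only the expansion is recorded,
  since Parseval's identity follows from it.\<close>

lemma (in inner_space) orthonormal_expansion:
  assumes "finite b" "b \<subseteq> V"
  shows "\<exists>n h. (\<forall>i<n::nat. h i \<in> span b) \<and>
    (\<forall>y\<in>span b. y = (\<Sum>i<n. scale (B y (h i)) (h i)))"
  using assms
proof (induction b)
  case empty
  show ?case by (rule exI[of _ 0]) auto
next
  case (insert a b)
  have "b \<subseteq> V" using insert.prems by simp
  from insert.IH[OF this] obtain n :: nat and h where nh: "\<forall>i<n. h i \<in> span b"
    "\<forall>y\<in>span b. y = (\<Sum>i<n. scale (B y (h i)) (h i))"
    by (elim exE conjE)
  have h: "h i \<in> span b" if "i < n" for i using nh(1) that by blast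
  have expand: "y = (\<Sum>i<n. scale (B y (h i)) (h i))" if "y \<in> span b" for y
    using nh(2) that by (rule bspec)
  have aV: "a \<in> V" using insert by auto
  have spV: "x \<in> V" if "x \<in> span b" for x
    using span_minimal[OF _ subspace_V, of b] insert.prems that by auto
  have hV: "h i \<in> V" if "i < n" for i using spV h that by auto
  define p where "p = (\<Sum>i<n. scale (B a (h i)) (h i))"
  have p: "p \<in> span b" unfolding p_def by (intro span_sum span_scale h) auto
  define a' where "a' = a - p"
  have a'V: "a' \<in> V" using aV p spV by (simp add: a'_def V_diff)
  have orth: "B a' y = 0" if y: "y \<in> span b" for y
  proof -
    have yV: "y \<in> V" using y spV by auto
    have "B a y = B a (\<Sum>i<n. scale (B y (h i)) (h i))" using expand[OF y] by simp
    also have "\<dots> = (\<Sum>i<n. B a (h i) * B (h i) y)"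
      using aV hV sym[OF yV hV]
      by (subst sum_right) (auto simp: V_scale scale_right mult.commute)
    also have "\<dots> = B p y"
      unfolding p_def using hV yV by (subst sum_left) (auto simp: V_scale scale_left)
    finally show ?thesis using aV p spV yV by (simp add: a'_def diff_left)
  qed
  show ?case
  proof (cases "a' = 0")
    case True
    then have "span (insert a b) = span b"
      using p by (intro span_redundant) (simp add: a'_def)
    then show ?thesis using nh by metis
  next
    case False
    define u where "u = scale (of_real (1 / nrm a')) a'"
    have r: "0 < nrm a'" using False nrm_nonneg[OF a'V] nrm_eq_0[OF a'V] by linarith
    have uV: "u \<in> V" by (simp add: u_def a'V V_scale)
    have a'u: "a' = scale (of_real (nrm a')) u" using r by (simp add: u_def)
    have "B a' a' = of_real ((nrm a')\<^sup>2)" using diag_real[OF a'V] nrm_sq[OF a'V] by simp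
    then have uu: "B u u = 1"
      using r a'V by (simp add: u_def form_simps power2_eq_square)
    have ub: "B u y = 0" if "y \<in> span b" for y
      using orth[OF that] that spV a'V by (simp add: u_def scale_left)
    have bu: "B y u = 0" if "y \<in> span b" for y
      using ub[OF that] sym[of u y] spV that uV by simp
    have uspan: "u \<in> span (insert a b)"
      unfolding u_def a'_def using p span_mono[of b "insert a b"]
      by (intro span_scale span_diff) (auto intro: span_base)
    define h' where "h' = h(n := u)"
    have "h' i \<in> span (insert a b)" if "i < Suc n" for i
      using that h uspan span_mono[of b "insert a b"] by (auto simp: h'_def less_Suc_eq)
    moreover have "y = (\<Sum>i<Suc n. scale (B y (h' i)) (h' i))" if y: "y \<in> span (insert a b)" for y
    proof -
      obtain k where k: "y - scale k a \<in> span b" using y span_breakdown_eq by blast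
      \<comment> \<open>This is y minus its component along u: as \<open>a = a' + p\<close>, it
        equals y minus k times \<open>a'\<close>, written so that membership in
        \<open>span b\<close> is visible.\<close>
      define s where "s = y - scale k a + scale k p"
      have s: "s \<in> span b" unfolding s_def using k p by (intro span_add span_scale)
      define c where "c = k * of_real (nrm a')"
      have "scale k a = scale k a' + scale k p"
        by (simp add: a'_def scale_right_diff_distrib)
      also have "scale k a' = scale c u" unfolding c_def by (subst a'u) simp
      finally have ys: "y = scale c u + s" by (simp add: s_def)
      have "B y (h i) = B s (h i)" if "i < n" for i
        unfolding ys using ub[OF h[OF that]] hV[OF that] uV spV s by (simp add: form_simps)
      moreover have "B y u = c"
        unfolding ys using bu[OF s] uu uV spV s by (simp add: form_simps)
      ultimately show ?thesis using ys expand[OF s] by (simp add: h'_def)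
    qed
    ultimately show ?thesis by blast
  qed
qed

text \<open>With \<open>h\<close> an orthonormal basis of the negative part this is the form
  \<open>[x\<^sub>+, y\<^sub>+] - [x\<^sub>-, y\<^sub>-]\<close>.  Only \<open>B\<close> and \<open>h\<close> enter, so the data of an orthogonal sum are obtained
  without decomposing it.\<close>

definition majorant ::
  "('v \<Rightarrow> 'v \<Rightarrow> complex) \<Rightarrow> 'i set \<Rightarrow> ('i \<Rightarrow> 'v) \<Rightarrow> 'v \<Rightarrow> 'v \<Rightarrow> complex" where
  "majorant B I h x y = B x y + 2 * (\<Sum>i\<in>I. B x (h i) * B (h i) y)"

text \<open>For an orthonormal basis h of the negative part the left-hand side of
  \<open>sum_le\<close> is \<open>- [x\<^sub>-, x\<^sub>-]\<close>. The inequality makes every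
  functional \<open>B _ (h i)\<close> bounded and passes termwise to orthogonal sums. The index type
  is free because such a sum is indexed by pairs.\<close>

locale finite_majorant = hermitian_space scale V B +
    G: complete_inner_space scale V "majorant B I h"
  for scale :: "complex \<Rightarrow> 'v::ab_group_add \<Rightarrow> 'v"
    and V B and I :: "'i set" and h +
  assumes finite_I: "finite I" and h_in: "i \<in> I \<Longrightarrow> h i \<in> V"
    and sum_le: "x \<in> V \<Longrightarrow> (\<Sum>i\<in>I. (cmod (B x (h i)))\<^sup>2) \<le> Re (majorant B I h x x)"

lemma (in hermitian_space) hermitian_majorant:
  assumes "\<And>i. i \<in> I \<Longrightarrow> h i \<in> V"
  shows "hermitian_form V (majorant B I h)"
  unfolding hermitian_form_def
proof (intro conjI ballI allI)
  fix x y z assume "x \<in> V" "y \<in> V" "z \<in> V"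
  then show "majorant B I h (x + y) z = majorant B I h x z + majorant B I h y z"
    using assms by (simp add: majorant_def add_left algebra_simps sum.distrib)
next
  fix x y c assume xy: "x \<in> V" "y \<in> V"
  have "(\<Sum>i\<in>I. B (scale c x) (h i) * B (h i) y) = c * (\<Sum>i\<in>I. B x (h i) * B (h i) y)"
    using xy assms unfolding sum_distrib_left
    by (intro sum.cong) (auto simp: scale_left)
  then show "majorant B I h (scale c x) y = c * majorant B I h x y"
    unfolding majorant_def scale_left[OF xy] by (simp only: distrib_left mult.left_commute)
next
  fix x y assume xy: "x \<in> V" "y \<in> V"
  have "(\<Sum>i\<in>I. B y (h i) * B (h i) x) = cnj (\<Sum>i\<in>I. B x (h i) * B (h i) y)"
    unfolding cnj_sum
  proof (rule sum.cong)
    fix i assume "i \<in> I"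
    then show "B y (h i) * B (h i) x = cnj (B x (h i) * B (h i) y)"
      using sym[OF xy(1) assms] sym[OF assms xy(2)] by simp
  qed simp
  then show "majorant B I h y x = cnj (majorant B I h x y)"
    using sym[OF xy] by (simp add: majorant_def)
qed

text \<open>Parseval's identity on \<open>Vm\<close>, a Hilbert space for \<open>- B\<close>, shows
  that adding twice the sum over h reverses the sign of the form on \<open>Vm\<close> and changes
  nothing on \<open>Vp\<close>. The majorant is thus the Hilbert sum of the two parts and inherits
  completeness from them. The clause on \<open>decomposition_norm\<close> serves the boundedness
  claim, which is phrased with that norm.\<close>

lemma (in complex_vector_space) fundamental_decomposition_finite_majorant:
  assumes V: "subspace V" "hermitian_form V B"
    and fd: "fundamental_decomposition V B Vp Vm"
    and b: "finite b" "span b = Vm"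
  shows "\<exists>I (h :: nat \<Rightarrow> 'v). finite_majorant scale V B I h \<and>
    (\<forall>x\<in>V. decomposition_norm B Vp Vm x = sqrt (Re (majorant B I h x x)))"
proof -
  let ?A = "\<lambda>x y. - B x y"
  interpret hermitian_space scale V B using V by unfold_locales
  have hp: "hilbert_space Vp B" and hm: "hilbert_space Vm ?A"
    and Veq: "V = {x + y | x y. x \<in> Vp \<and> y \<in> Vm}"
    and orth: "\<And>x y. x \<in> Vp \<Longrightarrow> y \<in> Vm \<Longrightarrow> B x y = 0"
    using fd by (auto simp: fundamental_decomposition_def)
  interpret P: complete_inner_space scale Vp B
    using hp by (rule hilbert_space_imp_complete_inner_space)
  interpret M: complete_inner_space scale Vm ?A
    using hm by (rule hilbert_space_imp_complete_inner_space)
  have PV: "x \<in> V" if "x \<in> Vp" for x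
    using that M.V_zero unfolding Veq by force
  have MV: "x \<in> V" if "x \<in> Vm" for x
    using that P.V_zero unfolding Veq by force
  have orth': "B y x = 0" if "x \<in> Vp" "y \<in> Vm" for x y
    using orth[OF that] sym[of x y] PV MV that by simp
  have "b \<subseteq> Vm" using b span_superset by auto
  from M.orthonormal_expansion[OF b(1) this] obtain n h
    where h: "\<And>i. i < n \<Longrightarrow> h i \<in> Vm"
      and expand: "\<And>y. y \<in> Vm \<Longrightarrow> y = (\<Sum>i<n::nat. scale (?A y (h i)) (h i))"
    unfolding b(2) by blast
  have hV: "h i \<in> V" if "i < n" for i using h MV that by auto
  let ?G = "majorant B {..<n} h"
  \<comment> \<open>The minus signs of \<open>?A x (h i)\<close> and \<open>?A (h i) y\<close>
    cancel in each product, while the one of \<open>?A x y\<close> remains.\<close>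
  have parseval: "(\<Sum>i<n. B x (h i) * B (h i) y) = - B x y" if "x \<in> Vm" "y \<in> Vm" for x y
  proof -
    have "?A x y = ?A (\<Sum>i<n. scale (?A x (h i)) (h i)) y" using expand[OF that(1)] by simp
    also have "\<dots> = (\<Sum>i<n. B x (h i) * B (h i) y)"
      using that h by (subst M.sum_left) (auto simp: M.V_scale scale_left MV hV simp del: scale_minus_left)
    finally show ?thesis by simp
  qed
  have Bh: "B (xp + xm) (h i) = B xm (h i)" "B (h i) (xp + xm) = B (h i) xm"
    if "xp \<in> Vp" "xm \<in> Vm" "i < n" for xp xm i
    using that orth[OF that(1) h[OF that(3)]] orth'[OF that(1) h[OF that(3)]] PV MV hV
    by (auto simp: add_left add_right)
  have G: "?G (xp + xm) (yp + ym) = B xp yp - B xm ym"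
    if "xp \<in> Vp" "yp \<in> Vp" "xm \<in> Vm" "ym \<in> Vm" for xp xm yp ym
  proof -
    have "(\<Sum>i<n. B (xp + xm) (h i) * B (h i) (yp + ym)) = - B xm ym"
      unfolding parseval[OF that(3,4), symmetric]
      by (rule sum.cong) (use that Bh in auto)
    moreover have "B (xp + xm) (yp + ym) = B xp yp + B xm ym"
      using that PV MV orth orth' by (simp add: add_left add_right V_add)
    ultimately show ?thesis by (simp add: majorant_def)
  qed
  interpret H: hermitian_space scale V ?G
    using V hermitian_majorant[of "{..<n}" h] hV by unfold_locales auto
  have split: "\<exists>xp xm. xp \<in> Vp \<and> xm \<in> Vm \<and> x = xp + xm" if "x \<in> V" for x
    using that unfolding Veq by blast
  interpret H: inner_space scale V ?G
  proof
    fix x assume x: "x \<in> V" "x \<noteq> 0"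
    from split[OF x(1)] obtain xp xm where s: "xp \<in> Vp" "xm \<in> Vm" "x = xp + xm" by blast
    have "0 < Re (B xp xp) \<or> 0 < Re (?A xm xm)"
      using P.pos[OF s(1)] M.pos[OF s(2)] x(2) s(3) by (metis add_0_left)
    then show "0 < Re (?G x x)"
      using P.Re_nonneg[OF s(1)] M.Re_nonneg[OF s(2)] unfolding s(3) G[OF s(1,1,2,2)] by auto
  qed
  \<comment> \<open>The first two bounds make both components of a Cauchy sequence Cauchy; the third
    recombines their limits.\<close>
  have Hn: "P.nrm xp \<le> H.nrm (xp + xm)" "M.nrm xm \<le> H.nrm (xp + xm)"
     "H.nrm (xp + xm) \<le> P.nrm xp + M.nrm xm"
    if "xp \<in> Vp" "xm \<in> Vm" for xp xm
  proof -
    have q: "Re (?G (xp + xm) (xp + xm)) = (P.nrm xp)\<^sup>2 + (M.nrm xm)\<^sup>2"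
      using that G by (simp add: P.nrm_sq M.nrm_sq)
    have nn: "0 \<le> P.nrm xp" "0 \<le> M.nrm xm" using that P.nrm_nonneg M.nrm_nonneg by auto
    show "P.nrm xp \<le> H.nrm (xp + xm)" "M.nrm xm \<le> H.nrm (xp + xm)"
      unfolding H.nrm_def q by (auto intro: real_le_rsqrt)
    show "H.nrm (xp + xm) \<le> P.nrm xp + M.nrm xm"
      unfolding H.nrm_def q using nn by (intro real_le_lsqrt) (auto simp: power2_sum)
  qed
  interpret H: complete_inner_space scale V ?G
  proof
    fix X :: "nat \<Rightarrow> 'v"
    assume X: "\<And>n. X n \<in> V" "\<And>e. 0 < e \<Longrightarrow> \<exists>M. \<forall>m\<ge>M. \<forall>n\<ge>M. H.nrm (X m - X n) < e"
    from split[OF X(1)] obtain p m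
      where pm: "\<And>n. p n \<in> Vp" "\<And>n. m n \<in> Vm" "\<And>n. X n = p n + m n" by metis
    have d: "X k - X l = (p k - p l) + (m k - m l)" for k l by (simp add: pm)
    have "\<exists>x\<in>Vp. (\<lambda>n. P.nrm (p n - x)) \<longlonglongrightarrow> 0"
    proof (rule P.complete[OF pm(1)])
      fix e :: real assume "0 < e"
      from X(2)[OF this] show "\<exists>M. \<forall>m\<ge>M. \<forall>n\<ge>M. P.nrm (p m - p n) < e"
        unfolding d using Hn(1) pm P.V_diff M.V_diff by (meson le_less_trans)
    qed
    then obtain x where x: "x \<in> Vp" "(\<lambda>n. P.nrm (p n - x)) \<longlonglongrightarrow> 0" by blast
    have "\<exists>x\<in>Vm. (\<lambda>n. M.nrm (m n - x)) \<longlonglongrightarrow> 0"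
    proof (rule M.complete[OF pm(2)])
      fix e :: real assume "0 < e"
      from X(2)[OF this] show "\<exists>M. \<forall>k\<ge>M. \<forall>n\<ge>M. M.nrm (m k - m n) < e"
        unfolding d using Hn(2) pm P.V_diff M.V_diff by (meson le_less_trans)
    qed
    then obtain y where y: "y \<in> Vm" "(\<lambda>n. M.nrm (m n - y)) \<longlonglongrightarrow> 0" by blast
    have "(\<lambda>n. H.nrm (X n - (x + y))) \<longlonglongrightarrow> 0"
    proof (rule Lim_null_comparison)
      show "\<forall>\<^sub>F n in sequentially. norm (H.nrm (X n - (x + y))) \<le> P.nrm (p n - x) + M.nrm (m n - y)"
      proof (rule always_eventually, rule allI)
        fix n
        have "X n - (x + y) = (p n - x) + (m n - y)" by (simp add: pm)
        then have "H.nrm (X n - (x + y)) = H.nrm ((p n - x) + (m n - y))" by (simp only:)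
        moreover have "X n - (x + y) \<in> V" using X(1) x y PV MV by (simp add: V_add V_diff)
        ultimately show "norm (H.nrm (X n - (x + y))) \<le> P.nrm (p n - x) + M.nrm (m n - y)"
          using Hn(3)[of "p n - x" "m n - y"] P.V_diff[OF pm(1) x(1), of n]
            M.V_diff[OF pm(2) y(1), of n] H.nrm_nonneg[of "X n - (x + y)"]
          by (metis abs_of_nonneg real_norm_def)
      qed
      show "(\<lambda>n. P.nrm (p n - x) + M.nrm (m n - y)) \<longlonglongrightarrow> 0"
        using tendsto_add[OF x(2) y(2)] by simp
    qed
    moreover have "x + y \<in> V" using x y PV MV by (simp add: V_add)
    ultimately show "\<exists>x\<in>V. (\<lambda>n. H.nrm (X n - x)) \<longlonglongrightarrow> 0" by blast
  qed
  have "finite_majorant scale V B {..<n} h"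
  proof
    fix x assume "x \<in> V"
    from split[OF this] obtain xp xm where s: "xp \<in> Vp" "xm \<in> Vm" "x = xp + xm" by blast
    have "(\<Sum>i<n. of_real ((cmod (B x (h i)))\<^sup>2)) = (\<Sum>i<n. B xm (h i) * B (h i) xm)"
    proof (rule sum.cong)
      fix i assume "i \<in> {..<n}"
      then have i: "i < n" by simp
      have "B (h i) xm = cnj (B xm (h i))" using sym[of xm "h i"] hV[OF i] MV[OF s(2)] by simp
      then show "of_real ((cmod (B x (h i)))\<^sup>2) = B xm (h i) * B (h i) xm"
        unfolding s(3) Bh(1)[OF s(1,2) i] by (simp only: complex_norm_square)
    qed simp
    also have "\<dots> = ?A xm xm" using parseval s by simp
    finally have "(\<Sum>i<n. (cmod (B x (h i)))\<^sup>2) = Re (?A xm xm)"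
      by (subst Re_complex_of_real[symmetric], subst of_real_sum) (rule arg_cong[where f = Re])
    then show "(\<Sum>i<n. (cmod (B x (h i)))\<^sup>2) \<le> Re (?G x x)"
      using P.Re_nonneg[OF s(1)] unfolding s(3) G[OF s(1,1,2,2)] by simp
  qed (use hV in auto)
  moreover have "decomposition_norm B Vp Vm x = sqrt (Re (?G x x))" if "x \<in> V" for x
  proof -
    from split[OF that] obtain xp xm where s: "xp \<in> Vp" "xm \<in> Vm" "x = xp + xm" by blast
    show ?thesis
      unfolding decomposition_norm_def
    proof (rule the_equality)
      show "\<exists>xp\<in>Vp. \<exists>xm\<in>Vm. x = xp + xm \<and> sqrt (Re (?G x x)) = sqrt (Re (B xp xp - B xm xm))"
        using s(1,2) unfolding s(3) G[OF s(1,1,2,2)] by blast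
    next
      \<comment> \<open>\<open>G\<close> holds for every splitting of x, so all of them yield the
        same value.\<close>
      fix r assume "\<exists>xp\<in>Vp. \<exists>xm\<in>Vm. x = xp + xm \<and> r = sqrt (Re (B xp xp - B xm xm))"
      then obtain yp ym where y: "yp \<in> Vp" "ym \<in> Vm" "x = yp + ym"
        and r: "r = sqrt (Re (B yp yp - B ym ym))" by blast
      show "r = sqrt (Re (?G x x))" unfolding r y(3) G[OF y(1,1,2,2)] ..
    qed
  qed
  ultimately show ?thesis by (intro exI[of _ "{..<n}"] exI[of _ h] conjI ballI)
qed

section \<open>Estimates in the norm of the majorant\<close>

context finite_majorant
begin

abbreviation nrm where "nrm \<equiv> G.nrm"

text \<open>A bound of the indefinite form for the Hilbert norm: 1 from the Cauchy-Schwarz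
  inequality for the majorant, and 2 for each product \<open>B x (h i) * B (h i) y\<close>, whose
  factors are bounded by the norms.\<close>

abbreviation bnd :: real where "bnd \<equiv> 1 + 2 * real (card I)"

lemma Re_majorant: "x \<in> V \<Longrightarrow> (nrm x)\<^sup>2 = Re (B x x) + 2 * (\<Sum>i\<in>I. (cmod (B x (h i)))\<^sup>2)"
proof -
  assume x: "x \<in> V"
  have "(\<Sum>i\<in>I. B x (h i) * B (h i) x) = (\<Sum>i\<in>I. of_real ((cmod (B x (h i)))\<^sup>2))"
  proof (rule sum.cong)
    fix i assume "i \<in> I"
    then show "B x (h i) * B (h i) x = of_real ((cmod (B x (h i)))\<^sup>2)"
      unfolding complex_norm_square using sym[OF x h_in] by simp
  qed simp
  then show ?thesis
    using x by (simp add: G.nrm_sq majorant_def flip: of_real_power of_real_sum)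
qed

lemma form_h_le:
  assumes x: "x \<in> V" and i: "i \<in> I"
  shows "cmod (B x (h i)) \<le> nrm x"
proof -
  have "(cmod (B x (h i)))\<^sup>2 \<le> (\<Sum>i\<in>I. (cmod (B x (h i)))\<^sup>2)"
    by (rule member_le_sum[OF i]) (auto simp: finite_I)
  then have "(cmod (B x (h i)))\<^sup>2 \<le> (nrm x)\<^sup>2"
    using sum_le[OF x] x by (simp add: G.nrm_sq)
  then show ?thesis using G.nrm_nonneg[OF x] power2_le_imp_le by blast
qed

lemma form_bounded:
  assumes x: "x \<in> V" and y: "y \<in> V"
  shows "cmod (B x y) \<le> bnd * nrm x * nrm y"
proof -
  have "cmod (\<Sum>i\<in>I. B x (h i) * B (h i) y) \<le> (\<Sum>i\<in>I. nrm x * nrm y)"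
  proof (rule sum_norm_le)
    fix i assume i: "i \<in> I"
    have "cmod (B (h i) y) = cmod (B y (h i))" using sym[OF y h_in[OF i]] by simp
    then show "cmod (B x (h i) * B (h i) y) \<le> nrm x * nrm y"
      unfolding norm_mult using form_h_le[OF x i] form_h_le[OF y i] by (simp add: mult_mono')
  qed
  moreover have "B x y = majorant B I h x y - 2 * (\<Sum>i\<in>I. B x (h i) * B (h i) y)"
    by (simp add: majorant_def)
  then have "cmod (B x y) \<le>
      cmod (majorant B I h x y) + 2 * cmod (\<Sum>i\<in>I. B x (h i) * B (h i) y)"
    using norm_triangle_ineq4[of "majorant B I h x y" "2 * (\<Sum>i\<in>I. B x (h i) * B (h i) y)"]
    by (simp add: norm_mult)
  ultimately show ?thesis using G.Cauchy_Schwarz[OF x y] by (simp add: algebra_simps)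
qed

lemma tendsto_form:
  assumes "\<And>n. X n \<in> V" "f \<in> V" "g \<in> V" "((\<lambda>n. nrm (f - X n)) \<longlongrightarrow> 0) F"
  shows "((\<lambda>n. B g (X n)) \<longlongrightarrow> B g f) F"
proof -
  have "((\<lambda>n. B g (f - X n)) \<longlongrightarrow> 0) F"
  proof (rule Lim_null_comparison)
    show "\<forall>\<^sub>F n in F. norm (B g (f - X n)) \<le> bnd * nrm g * nrm (f - X n)"
      using form_bounded[OF assms(3) V_diff[OF assms(2) assms(1)]] by simp
    show "((\<lambda>n. bnd * nrm g * nrm (f - X n)) \<longlongrightarrow> 0) F"
      using assms(4) by (rule tendsto_mult_right_zero)
  qed
  then have "((\<lambda>n. B g f - B g (X n)) \<longlongrightarrow> 0) F"
    using assms by (simp add: diff_right)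
  from tendsto_diff[OF tendsto_const[of "B g f"] this] show ?thesis by simp
qed

text \<open>The projection argument asks for a trivial complement with respect to the majorant,
  while \<open>sep\<close> speaks of B. The finite-rank correction \<open>g'\<close> translates: the
  majorant of g and y is \<open>B g' y\<close>, so orthogonality of g to D gives
  \<open>g' = 0\<close> and then a vanishing norm of g.\<close>

lemma dense_if_separating:
  assumes D: "subspace D" "D \<subseteq> V"
    and sep: "\<And>g. g \<in> V \<Longrightarrow> (\<And>d. d \<in> D \<Longrightarrow> B g d = 0) \<Longrightarrow> g = 0"
    and f: "f \<in> V" and e: "0 < e"
  shows "\<exists>d\<in>D. nrm (f - d) < e"
proof (rule G.dense_if_trivial_complement[OF D _ f e])
  fix g assume g: "g \<in> V" and orth: "\<And>d. d \<in> D \<Longrightarrow> majorant B I h g d = 0"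
  define g' where "g' = g + (\<Sum>i\<in>I. scale (2 * B g (h i)) (h i))"
  have g': "g' \<in> V" unfolding g'_def using g h_in by (intro V_add V_sum V_scale)
  have eq: "majorant B I h g y = B g' y" if "y \<in> V" for y
  proof -
    have "B g' y = B g y + B (\<Sum>i\<in>I. scale (2 * B g (h i)) (h i)) y"
      unfolding g'_def using that g h_in by (intro add_left V_sum V_scale)
    also have "B (\<Sum>i\<in>I. scale (2 * B g (h i)) (h i)) y = (\<Sum>i\<in>I. 2 * B g (h i) * B (h i) y)"
      using that h_in by (subst sum_left) (auto simp: V_scale scale_left)
    finally show ?thesis by (simp add: majorant_def sum_distrib_left mult.assoc)
  qed
  have "g' = 0" using sep[OF g'] eq orth D by (metis subsetD)
  then have "majorant B I h g g = 0" using eq[OF g] zero_left[OF g] by simp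
  then show "g = 0" using G.pos[OF g] by fastforce
qed

text \<open>The right-hand side involves the majorant only through finitely many vectors of \<open>D\<close>, so
  two majorants restrict to equivalent norms on a subspace that is dense for both.\<close>

lemma nrm_le_form:
  assumes D: "subspace D" "D \<subseteq> V"
    and sep: "\<And>g. g \<in> V \<Longrightarrow> (\<And>d. d \<in> D \<Longrightarrow> B g d = 0) \<Longrightarrow> g = 0"
  shows "\<exists>e. (\<forall>i\<in>I. e i \<in> D) \<and>
    (\<forall>x\<in>V. (nrm x)\<^sup>2 \<le> 2 * Re (B x x) + 8 * (\<Sum>i\<in>I. (cmod (B x (e i)))\<^sup>2))"
proof -
  have b1: "1 \<le> bnd" by simp
  have scaled_sq: "2 * (r / (2 * b))\<^sup>2 = r\<^sup>2 / (2 * b\<^sup>2)" for r b :: real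
    by (simp add: power_divide power_mult_distrib)
  \<comment> \<open>The tolerance is spent as follows: \<open>form_bounded\<close> costs one factor
    \<open>bnd\<close>, which leaves an error \<open>nrm x / (2 * bnd)\<close>; twice its square,
    summed over I, is at most a quarter of the squared norm.\<close>
  have "0 < 1 / (2 * bnd\<^sup>2)" using b1 by (intro divide_pos_pos mult_pos_pos zero_less_power) auto
  then have "\<exists>d\<in>D. nrm (h i - d) < 1 / (2 * bnd\<^sup>2)" if "i \<in> I" for i
    using dense_if_separating[OF D sep h_in[OF that]] by blast
  then obtain e where e: "\<And>i. i \<in> I \<Longrightarrow> e i \<in> D"
    "\<And>i. i \<in> I \<Longrightarrow> nrm (h i - e i) < 1 / (2 * bnd\<^sup>2)" by metis
  have eV: "e i \<in> V" if "i \<in> I" for i using e that D by auto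
  have "(nrm x)\<^sup>2 \<le> 2 * Re (B x x) + 8 * (\<Sum>i\<in>I. (cmod (B x (e i)))\<^sup>2)" if x: "x \<in> V" for x
  proof -
    have nn: "0 \<le> nrm x" using x by (rule G.nrm_nonneg)
    have one: "(cmod (B x (h i)))\<^sup>2 \<le> 2 * (cmod (B x (e i)))\<^sup>2 + (nrm x)\<^sup>2 / (2 * bnd\<^sup>2)"
      if i: "i \<in> I" for i
    proof -
      have "cmod (B x (h i - e i)) \<le> bnd * nrm x * nrm (h i - e i)"
        using form_bounded x h_in eV i by (simp add: V_diff)
      also have "\<dots> \<le> bnd * nrm x * (1 / (2 * bnd\<^sup>2))"
        using e(2)[OF i] nn b1 by (intro mult_left_mono) auto
      also have "\<dots> = nrm x / (2 * bnd)" using b1 by (simp add: power2_eq_square)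
      finally have "cmod (B x (h i - e i)) \<le> nrm x / (2 * bnd)" .
      moreover have "B x (h i) = B x (e i) + B x (h i - e i)"
        using x h_in eV i by (simp add: diff_right)
      ultimately have "cmod (B x (h i)) \<le> cmod (B x (e i)) + nrm x / (2 * bnd)"
        using norm_triangle_ineq[of "B x (e i)" "B x (h i - e i)"] by simp
      then have "(cmod (B x (h i)))\<^sup>2 \<le> (cmod (B x (e i)) + nrm x / (2 * bnd))\<^sup>2"
        by (intro power_mono) auto
      also have "\<dots> \<le> 2 * (cmod (B x (e i)))\<^sup>2 + 2 * (nrm x / (2 * bnd))\<^sup>2"
        using zero_le_power2[of "cmod (B x (e i)) - nrm x / (2 * bnd)"]
        by (simp only: power2_sum power2_diff)
      also have "2 * (nrm x / (2 * bnd))\<^sup>2 = (nrm x)\<^sup>2 / (2 * bnd\<^sup>2)"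
        by (rule scaled_sq)
      finally show ?thesis .
    qed
    have "(\<Sum>i\<in>I. (cmod (B x (h i)))\<^sup>2) \<le>
        (\<Sum>i\<in>I. 2 * (cmod (B x (e i)))\<^sup>2 + (nrm x)\<^sup>2 / (2 * bnd\<^sup>2))"
      by (rule sum_mono[OF one])
    also have "\<dots> = 2 * (\<Sum>i\<in>I. (cmod (B x (e i)))\<^sup>2) + (card I / (2 * bnd\<^sup>2)) * (nrm x)\<^sup>2"
      by (simp add: sum.distrib sum_distrib_left)
    also have "card I / (2 * bnd\<^sup>2) \<le> 1 / 4"
    proof -
      have "2 * real (card I) \<le> bnd\<^sup>2" by (simp add: power2_eq_square algebra_simps)
      then show ?thesis using b1 by (simp add: field_simps)
    qed
    finally have "(\<Sum>i\<in>I. (cmod (B x (h i)))\<^sup>2) \<le>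
        2 * (\<Sum>i\<in>I. (cmod (B x (e i)))\<^sup>2) + 1 / 4 * (nrm x)\<^sup>2"
      by (simp add: mult_right_mono)
    \<comment> \<open>The sum enters the squared norm with weight 2, so half of the squared norm
      moves to the left; doubling yields the constants 2 and 8.\<close>
    then show ?thesis using Re_majorant[OF x] by linarith
  qed
  then show ?thesis using e(1) by blast
qed

end

section \<open>Reproducing kernel Pontryagin spaces\<close>

definition section_span :: "complex set \<Rightarrow> (complex \<Rightarrow> complex \<Rightarrow> complex^'p^'p) \<Rightarrow> (complex \<Rightarrow> complex^'p) set"
  where "section_span \<Omega> K = vfun.span {kernel_section \<Omega> K w \<xi> | w \<xi>. w \<in> \<Omega>}"

locale rk_majorant = finite_majorant vfun_scale V B I h
  for V :: "(complex \<Rightarrow> complex^'p) set" and B and I :: "'i set" and h +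
  fixes \<Omega> :: "complex set" and K :: "complex \<Rightarrow> complex \<Rightarrow> complex^'p^'p"
  assumes vanish: "f \<in> V \<Longrightarrow> z \<notin> \<Omega> \<Longrightarrow> f z = 0"
    and section_in: "w \<in> \<Omega> \<Longrightarrow> kernel_section \<Omega> K w \<xi> \<in> V"
    and reproducing: "f \<in> V \<Longrightarrow> w \<in> \<Omega> \<Longrightarrow>
      B f (kernel_section \<Omega> K w \<xi>) = (\<Sum>i\<in>UNIV. cnj (\<xi> $ i) * f w $ i)"
begin

lemma reproducing_axis:
  assumes "f \<in> V" "w \<in> \<Omega>"
  shows "B f (kernel_section \<Omega> K w (axis i 1)) = f w $ i"
proof -
  have "B f (kernel_section \<Omega> K w (axis i 1)) = (\<Sum>j\<in>UNIV. if j = i then f w $ j else 0)"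
    unfolding reproducing[OF assms] by (rule sum.cong) (auto simp: axis_def)
  then show ?thesis by simp
qed

lemma section_span_V: "section_span \<Omega> K \<subseteq> V"
  unfolding section_span_def by (rule span_minimal) (use section_in subspace_V in auto)

lemma subspace_section_span: "vfun.subspace (section_span \<Omega> K)"
  unfolding section_span_def by (rule subspace_span)

lemma section_in_span: "w \<in> \<Omega> \<Longrightarrow> kernel_section \<Omega> K w \<xi> \<in> section_span \<Omega> K"
  unfolding section_span_def by (rule span_base) auto

lemma eqI:
  assumes "f \<in> V" "g \<in> V" "\<And>w \<xi>. w \<in> \<Omega> \<Longrightarrow>
    B f (kernel_section \<Omega> K w \<xi>) = B g (kernel_section \<Omega> K w \<xi>)"
  shows "f = g"
proof
  fix z
  show "f z = g z"
  proof (cases "z \<in> \<Omega>")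
    case True
    then show ?thesis
      using assms reproducing_axis[of f z] reproducing_axis[of g z] by (simp add: Finite_Cartesian_Product.vec_eq_iff)
  qed (simp add: vanish assms(1,2))
qed

lemma separating:
  assumes "g \<in> V" "\<And>d. d \<in> section_span \<Omega> K \<Longrightarrow> B g d = 0"
  shows "g = 0"
  using assms by (intro eqI) (auto simp: V_zero zero_left section_in section_in_span)

text \<open>This makes an adjoint unique, so that the description in \<open>krein_adjoint\<close>
  denotes.\<close>

lemma form_nondegenerate:
  assumes "f \<in> V" "g \<in> V" "\<And>x. x \<in> V \<Longrightarrow> B x f = B x g"
  shows "f = g"
proof (rule eqI[OF assms(1,2)])
  fix w \<xi> assume "w \<in> \<Omega>"
  then have "kernel_section \<Omega> K w \<xi> \<in> V" by (rule section_in)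
  then show "B f (kernel_section \<Omega> K w \<xi>) = B g (kernel_section \<Omega> K w \<xi>)"
    using assms sym by metis
qed

lemma section_span_dense:
  assumes "f \<in> V"
  obtains d :: "nat \<Rightarrow> complex \<Rightarrow> complex^'p"
    where "\<And>n. d n \<in> section_span \<Omega> K" "(\<lambda>n. nrm (f - d n)) \<longlonglongrightarrow> 0"
proof -
  have "\<exists>d\<in>section_span \<Omega> K. nrm (f - d) < 1 / Suc n" for n
    by (rule dense_if_separating[OF subspace_section_span section_span_V separating assms]) auto
  then obtain d where d: "\<And>n. d n \<in> section_span \<Omega> K" "\<And>n. nrm (f - d n) < 1 / Suc n" by metis
  have "(\<lambda>n. nrm (f - d n)) \<longlonglongrightarrow> 0"
  proof (rule Lim_null_comparison[OF _ LIMSEQ_Suc[OF lim_1_over_n]])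
    show "\<forall>\<^sub>F n in sequentially. norm (nrm (f - d n)) \<le> 1 / real (Suc n)"
      using d assms section_span_V G.nrm_nonneg
      by (intro always_eventually allI) (simp add: V_diff subset_iff less_imp_le)
  qed
  with d(1) show ?thesis by (rule that)
qed

lemmas nrm_le_form_section_span =
  nrm_le_form[OF subspace_section_span section_span_V separating]

text \<open>Evaluation at w is pairing with a kernel section, hence continuous in norm. This
  identifies limits that are taken in two different spaces of functions.\<close>

lemma tendsto_eval:
  assumes "\<And>n. X n \<in> V" "f \<in> V" "((\<lambda>n. nrm (f - X n)) \<longlongrightarrow> 0) F" "w \<in> \<Omega>"
  shows "((\<lambda>n. X n w $ i) \<longlongrightarrow> f w $ i) F"
proof -
  let ?k = "kernel_section \<Omega> K w (axis i 1)"
  have k: "?k \<in> V" using assms(4) by (rule section_in)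
  have eq: "cnj (B ?k g) = g w $ i" if "g \<in> V" for g
    using sym[OF k that] reproducing_axis[OF that assms(4)] by simp
  have "((\<lambda>n. cnj (B ?k (X n))) \<longlongrightarrow> cnj (B ?k f)) F"
    by (intro tendsto_cnj tendsto_form assms k)
  then show ?thesis by (simp only: eq assms)
qed

end

section \<open>Uniqueness of the space with a given kernel\<close>

lemma form_eq_on_section_span:
  assumes "rk_majorant V1 B1 I1 h1 \<Omega> K" "rk_majorant V2 B2 I2 h2 \<Omega> K"
    and f: "f \<in> V1" "f \<in> V2" and d: "d \<in> section_span \<Omega> K"
  shows "B1 f d = B2 f d"
proof -
  interpret r1: rk_majorant V1 B1 I1 h1 \<Omega> K by fact
  interpret r2: rk_majorant V2 B2 I2 h2 \<Omega> K by fact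
  have "d \<in> V1 \<and> d \<in> V2 \<and> B1 f d = B2 f d"
    using d unfolding section_span_def
  proof (induction rule: vfun.span_induct_alt)
    case base
    show ?case
      by (intro conjI r1.V_zero r2.V_zero) (simp only: r1.zero_right[OF f(1)] r2.zero_right[OF f(2)])
  next
    case (step c k y)
    then obtain w \<xi> where w: "w \<in> \<Omega>" and k: "k = kernel_section \<Omega> K w \<xi>" by auto
    have "B1 f k = B2 f k" unfolding k r1.reproducing[OF f(1) w] r2.reproducing[OF f(2) w] ..
    moreover have "k \<in> V1" "k \<in> V2" unfolding k using w r1.section_in r2.section_in by auto
    moreover have "y \<in> V1" "y \<in> V2" "B1 f y = B2 f y" using step by auto
    ultimately show ?case
      by (simp only: f r1.V_add r2.V_add r1.V_scale r2.V_scale r1.add_right r2.add_right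
          r1.scale_right r2.scale_right simp_thms)
  qed
  then show ?thesis by blast
qed

text \<open>On the span of the kernel sections the two forms agree, so the estimate of
  \<open>nrm_le_form\<close> for the first norm has a right-hand side that the second norm controls.
  Approximants of f from the span that converge in the second norm are then Cauchy in the first, and
  pointwise evaluation shows that both limits are f. The forms agree by passing to the limit in
  their second argument.\<close>

lemma rk_majorant_subset:
  assumes R1: "rk_majorant V1 B1 I1 h1 \<Omega> K" and R2: "rk_majorant V2 B2 I2 h2 \<Omega> K"
    and f: "f \<in> V2"
  shows "f \<in> V1 \<and> (\<forall>g\<in>V1 \<inter> V2. B1 g f = B2 g f)"
proof -
  interpret r1: rk_majorant V1 B1 I1 h1 \<Omega> K by fact
  interpret r2: rk_majorant V2 B2 I2 h2 \<Omega> K by fact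
  let ?D = "section_span \<Omega> K"
  have D1: "x \<in> V1" and D2: "x \<in> V2" if "x \<in> ?D" for x
    using that r1.section_span_V r2.section_span_V by auto
  obtain e where e: "\<And>i. i \<in> I1 \<Longrightarrow> e i \<in> ?D"
    and le: "\<And>x. x \<in> V1 \<Longrightarrow>
      (r1.nrm x)\<^sup>2 \<le> 2 * Re (B1 x x) + 8 * (\<Sum>i\<in>I1. (cmod (B1 x (e i)))\<^sup>2)"
    using r1.nrm_le_form_section_span by blast
  \<comment> \<open>The right-hand side of \<open>le\<close>, with \<open>B1\<close> read as
    \<open>B2\<close> and each value of the form bounded by \<open>r2.bnd\<close> times the two
    norms.\<close>
  define C where "C = 2 * r2.bnd + 8 * (\<Sum>i\<in>I1. (r2.bnd * r2.nrm (e i))\<^sup>2)"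
  have C0: "0 \<le> C" unfolding C_def by (intro add_nonneg_nonneg mult_nonneg_nonneg sum_nonneg) auto
  have collect: "2 * (a * n * n) + 8 * (s * n\<^sup>2) = (2 * a + 8 * s) * n\<^sup>2" for a n s :: real
    by (simp add: power2_eq_square algebra_simps)
  have le2: "r1.nrm x \<le> sqrt C * r2.nrm x" if x: "x \<in> ?D" for x
  proof -
    have "Re (B1 x x) \<le> r2.bnd * r2.nrm x * r2.nrm x"
      unfolding form_eq_on_section_span[OF R1 R2 D1[OF x] D2[OF x] x]
      using r2.form_bounded[OF D2[OF x] D2[OF x]] complex_Re_le_cmod order_trans by blast
    moreover have "(\<Sum>i\<in>I1. (cmod (B1 x (e i)))\<^sup>2) \<le>
        (\<Sum>i\<in>I1. (r2.bnd * r2.nrm (e i))\<^sup>2 * (r2.nrm x)\<^sup>2)"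
    proof (rule sum_mono)
      fix i assume i: "i \<in> I1"
      have "cmod (B1 x (e i)) \<le> r2.bnd * r2.nrm x * r2.nrm (e i)"
        unfolding form_eq_on_section_span[OF R1 R2 D1[OF x] D2[OF x] e[OF i]]
        by (rule r2.form_bounded[OF D2[OF x] D2[OF e[OF i]]])
      then have "(cmod (B1 x (e i)))\<^sup>2 \<le> (r2.bnd * r2.nrm x * r2.nrm (e i))\<^sup>2"
        by (intro power_mono) auto
      then show "(cmod (B1 x (e i)))\<^sup>2 \<le> (r2.bnd * r2.nrm (e i))\<^sup>2 * (r2.nrm x)\<^sup>2"
        by (simp add: power_mult_distrib mult_ac)
    qed
    ultimately have "(r1.nrm x)\<^sup>2 \<le> 2 * (r2.bnd * r2.nrm x * r2.nrm x) +
        8 * (\<Sum>i\<in>I1. (r2.bnd * r2.nrm (e i))\<^sup>2 * (r2.nrm x)\<^sup>2)"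
      using le[OF D1[OF x]] by linarith
    also have "\<dots> = C * (r2.nrm x)\<^sup>2"
      unfolding C_def sum_distrib_right[symmetric] by (rule collect)
    finally have "(r1.nrm x)\<^sup>2 \<le> (sqrt C * r2.nrm x)\<^sup>2"
      using C0 by (simp add: power_mult_distrib)
    then show ?thesis
      using C0 r2.G.nrm_nonneg[OF D2[OF x]] by (auto intro: power2_le_imp_le)
  qed
  obtain d where d: "\<And>n. d n \<in> ?D" and lim2: "(\<lambda>n. r2.nrm (f - d n)) \<longlonglongrightarrow> 0"
    using r2.section_span_dense[OF f] by blast
  have "\<exists>M. \<forall>m\<ge>M. \<forall>n\<ge>M. r1.nrm (d m - d n) < \<epsilon>" if \<epsilon>: "0 < \<epsilon>" for \<epsilon>
  proof -
    have cancel: "a * (2 * (e / (2 * a))) = e" if "0 < 2 * a" for a e :: real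
      using that by simp
    \<comment> \<open>The 2 accounts for the two approximants \<open>d m\<close> and
      \<open>d n\<close>; the added 1 makes the denominator positive on the strength of
      \<open>C0\<close> alone.\<close>
    define \<eta> where "\<eta> = \<epsilon> / (2 * (sqrt C + 1))"
    have s0: "0 \<le> sqrt C" using C0 by simp
    have "0 < 2 * (sqrt C + 1)" by (intro mult_pos_pos add_nonneg_pos s0) auto
    then have "0 < \<eta>" unfolding \<eta>_def by (rule divide_pos_pos[OF \<epsilon>])
    with lim2 obtain M where M: "\<And>n. n \<ge> M \<Longrightarrow> r2.nrm (f - d n) < \<eta>"
      using order_tendstoD(2)[of _ 0 sequentially \<eta>] unfolding eventually_sequentially by blast
    have "r1.nrm (d m - d n) < \<epsilon>" if "m \<ge> M" "n \<ge> M" for m n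
    proof -
      have mn: "d m - d n \<in> ?D"
        using d r1.subspace_section_span by (intro vfun.subspace_diff)
      have "r2.nrm (d m - d n) \<le> r2.nrm (f - d m) + r2.nrm (f - d n)"
        using r2.G.nrm_triangle_diff[OF D2[OF d] f D2[OF d]]
          r2.G.nrm_minus_commute[OF D2[OF d] f] by metis
      also have "\<dots> < 2 * \<eta>" using M[OF that(1)] M[OF that(2)] by simp
      finally have "sqrt C * r2.nrm (d m - d n) \<le> sqrt C * (2 * \<eta>)"
        using s0 by (intro mult_left_mono) auto
      also have "\<dots> < (sqrt C + 1) * (2 * \<eta>)" using \<open>0 < \<eta>\<close> by (simp add: distrib_right)
      also have "\<dots> = \<epsilon>" unfolding \<eta>_def using \<open>0 < 2 * (sqrt C + 1)\<close> by (rule cancel)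
      finally show ?thesis using le2[OF mn] by linarith
    qed
    then show ?thesis by blast
  qed
  from r1.G.complete[OF D1[OF d] this]
  obtain g where g: "g \<in> V1" and "(\<lambda>n. r1.nrm (d n - g)) \<longlonglongrightarrow> 0" by blast
  then have lim1: "(\<lambda>n. r1.nrm (g - d n)) \<longlonglongrightarrow> 0"
    using r1.G.nrm_minus_commute[OF g D1[OF d]] by simp
  have "g = f"
  proof
    fix z
    show "g z = f z"
    proof (cases "z \<in> \<Omega>")
      case True
      have "g z $ i = f z $ i" for i
        using r1.tendsto_eval[OF D1[OF d] g lim1 True] r2.tendsto_eval[OF D2[OF d] f lim2 True]
          LIMSEQ_unique by blast
      then show ?thesis by (simp add: Finite_Cartesian_Product.vec_eq_iff)
    qed (use r1.vanish[OF g] r2.vanish[OF f] in simp)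
  qed
  moreover have "B1 k f = B2 k f" if k: "k \<in> V1" "k \<in> V2" for k
  proof -
    have "(\<lambda>n. B1 k (d n)) \<longlonglongrightarrow> B1 k f"
      using r1.tendsto_form[OF D1[OF d] g k(1) lim1] \<open>g = f\<close> by simp
    moreover have "(\<lambda>n. B1 k (d n)) \<longlonglongrightarrow> B2 k f"
      unfolding form_eq_on_section_span[OF R1 R2 k d] by (rule r2.tendsto_form[OF D2[OF d] f k(2) lim2])
    ultimately show ?thesis by (rule LIMSEQ_unique)
  qed
  ultimately show ?thesis using g by blast
qed

lemma rk_majorant_unique:
  assumes R1: "rk_majorant V1 B1 I1 h1 \<Omega> K" and R2: "rk_majorant V2 B2 I2 h2 \<Omega> K"
  shows "V1 = V2" "f \<in> V1 \<Longrightarrow> g \<in> V1 \<Longrightarrow> B1 f g = B2 f g"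
proof -
  show eq: "V1 = V2" using rk_majorant_subset[OF R1 R2] rk_majorant_subset[OF R2 R1] by blast
  show "f \<in> V1 \<Longrightarrow> g \<in> V1 \<Longrightarrow> B1 f g = B2 f g"
    using rk_majorant_subset[OF R1 R2] eq by blast
qed

section \<open>Continuity of the elements at a point\<close>

context rk_majorant
begin

text \<open>The continuity assumptions make every element of the span of the kernel sections continuous
  at \<open>w0\<close>, so the norm estimate turns them into norm continuity of the kernel sections.\<close>

lemma continuous_at_point:
  assumes w0: "w0 \<in> \<Omega>"
    and Kl: "\<And>u \<xi> i. u \<in> \<Omega> \<Longrightarrow> ((\<lambda>w. (K w u *v \<xi>) $ i) \<longlongrightarrow> (K w0 u *v \<xi>) $ i) (at w0 within \<Omega>)"
    and Kr: "\<And>\<xi> i. ((\<lambda>w. (K w0 w *v \<xi>) $ i) \<longlongrightarrow> (K w0 w0 *v \<xi>) $ i) (at w0 within \<Omega>)"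
    and Kd: "\<And>\<xi> i. ((\<lambda>w. (K w w *v \<xi>) $ i) \<longlongrightarrow> (K w0 w0 *v \<xi>) $ i) (at w0 within \<Omega>)"
    and f: "f \<in> V"
  shows "((\<lambda>w. f w $ i) \<longlongrightarrow> f w0 $ i) (at w0 within \<Omega>)"
proof -
  let ?F = "at w0 within \<Omega>"
  define k where "k = (\<lambda>w. kernel_section \<Omega> K w (axis i 1))"
  define x where "x = (\<lambda>w. k w - k w0)"
  have kV: "k w \<in> V" if "w \<in> \<Omega>" for w unfolding k_def using that by (rule section_in)
  have xV: "x w \<in> V" if "w \<in> \<Omega>" for w unfolding x_def using kV that w0 by (simp add: V_diff)
  have Bx: "B g (x w) = g w $ i - g w0 $ i" if "g \<in> V" "w \<in> \<Omega>" for g w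
    unfolding x_def diff_right[OF kV[OF that(2)] kV[OF w0] that(1)]
    unfolding k_def by (simp only: reproducing_axis that w0)
  have ev: "\<forall>\<^sub>F w in ?F. w \<in> \<Omega>" by (simp add: eventually_at_filter)
  have cont_D: "((\<lambda>w. d w $ j) \<longlongrightarrow> d w0 $ j) ?F" if "d \<in> section_span \<Omega> K" for d j
    using that unfolding section_span_def
  proof (induction rule: vfun.span_induct_alt)
    case (step c s y)
    then obtain u \<xi> where u: "u \<in> \<Omega>" and s: "s = kernel_section \<Omega> K u \<xi>" by auto
    have "((\<lambda>w. s w $ j) \<longlongrightarrow> (K w0 u *v \<xi>) $ j) ?F"
      by (rule Lim_transform_eventually[OF Kl[OF u, of \<xi> j]])
        (use ev in eventually_elim, simp add: s kernel_section_def)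
    then have "((\<lambda>w. s w $ j) \<longlongrightarrow> s w0 $ j) ?F" using w0 by (simp add: s kernel_section_def)
    then have "((\<lambda>w. c * s w $ j + y w $ j) \<longlongrightarrow> c * s w0 $ j + y w0 $ j) ?F"
      by (intro tendsto_add tendsto_mult_left step.IH)
    then show ?case by (simp add: vfun_scale_def)
  qed simp
  obtain e where e: "\<And>i. i \<in> I \<Longrightarrow> e i \<in> section_span \<Omega> K"
    and le: "\<And>x. x \<in> V \<Longrightarrow>
      (nrm x)\<^sup>2 \<le> 2 * Re (B x x) + 8 * (\<Sum>i\<in>I. (cmod (B x (e i)))\<^sup>2)"
    using nrm_le_form_section_span by blast
  \<comment> \<open>The right-hand side of \<open>le\<close> at \<open>x w\<close>, written out by
    the reproducing property: the square of a difference of two sections is a combination of four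
    kernel entries, and pairing with \<open>e j\<close> gives an increment of \<open>e j\<close>.
    Every term tends to 0.\<close>
  define b where "b = (\<lambda>w. 2 * Re (((K w w *v axis i 1) $ i - (K w w0 *v axis i 1) $ i)
      - ((K w0 w *v axis i 1) $ i - (K w0 w0 *v axis i 1) $ i))
      + 8 * (\<Sum>j\<in>I. (cmod (e j w $ i - e j w0 $ i))\<^sup>2))"
  have "(b \<longlongrightarrow> 2 * Re (((K w0 w0 *v axis i 1) $ i - (K w0 w0 *v axis i 1) $ i)
      - ((K w0 w0 *v axis i 1) $ i - (K w0 w0 *v axis i 1) $ i))
      + 8 * (\<Sum>j\<in>I. (cmod (e j w0 $ i - e j w0 $ i))\<^sup>2)) ?F"
    unfolding b_def by (intro tendsto_intros Kd Kl[OF w0] Kr cont_D[OF e])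
  then have b0: "(b \<longlongrightarrow> 0) ?F" by simp
  have xb: "(nrm (x w))\<^sup>2 \<le> b w" if w: "w \<in> \<Omega>" for w
  proof -
    have "B (x w) (x w) = ((K w w *v axis i 1) $ i - (K w w0 *v axis i 1) $ i)
      - ((K w0 w *v axis i 1) $ i - (K w0 w0 *v axis i 1) $ i)"
      using w w0 unfolding Bx[OF xV[OF w] w]
      by (simp add: x_def k_def kernel_section_def)
    moreover have "(\<Sum>j\<in>I. (cmod (B (x w) (e j)))\<^sup>2) = (\<Sum>j\<in>I. (cmod (e j w $ i - e j w0 $ i))\<^sup>2)"
    proof (rule sum.cong)
      fix j assume j: "j \<in> I"
      have ejV: "e j \<in> V" using e[OF j] section_span_V by blast
      have "B (x w) (e j) = cnj (B (e j) (x w))" by (rule sym[OF ejV xV[OF w]])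
      then show "(cmod (B (x w) (e j)))\<^sup>2 = (cmod (e j w $ i - e j w0 $ i))\<^sup>2"
        unfolding Bx[OF ejV w] by (simp only: complex_mod_cnj)
    qed simp
    ultimately show ?thesis using le[OF xV[OF w]] unfolding b_def by simp
  qed
  have "((\<lambda>w. f w $ i - f w0 $ i) \<longlongrightarrow> 0) ?F"
  proof (rule Lim_null_comparison)
    show "\<forall>\<^sub>F w in ?F. norm (f w $ i - f w0 $ i) \<le> bnd * nrm f * sqrt (b w)"
      using ev
    proof eventually_elim
      case (elim w)
      have "cmod (B f (x w)) \<le> bnd * nrm f * nrm (x w)" by (rule form_bounded[OF f xV[OF elim]])
      also have "\<dots> \<le> bnd * nrm f * sqrt (b w)"
        using xb[OF elim] G.nrm_nonneg[OF f] by (intro mult_left_mono real_le_rsqrt) auto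
      finally show ?case unfolding Bx[OF f elim] .
    qed
    show "((\<lambda>w. bnd * nrm f * sqrt (b w)) \<longlongrightarrow> 0) ?F"
      using tendsto_mult_right_zero[OF tendsto_real_sqrt[OF b0, unfolded real_sqrt_zero]] .
  qed
  then show ?thesis by (simp only: LIM_zero_iff)
qed

end

section \<open>The substitution of a power\<close>

text \<open>Only finitely many w satisfy w^N = z^N, so the power avoids the value z^N near z and
  tends to it within the punctured filter in which a pole is defined.\<close>

lemma is_pole_power:
  assumes "is_pole f (z ^ N)" "0 < N"
  shows "is_pole (\<lambda>w. f (w ^ N)) (z :: complex)"
proof -
  have "finite {w. w ^ N = z ^ N}" using assms(2) by (rule finite_nth_roots)
  then have "\<not> z islimpt {w. w ^ N = z ^ N}" by (rule islimpt_finite)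
  then have "\<forall>\<^sub>F w in at z. w ^ N \<noteq> z ^ N"
    by (simp add: islimpt_iff_eventually)
  then have "filterlim (\<lambda>w. w ^ N) (at (z ^ N)) (at z)"
    by (intro filterlim_atI tendsto_intros)
  with assms(1) show ?thesis unfolding is_pole_def by (rule filterlim_compose)
qed

text \<open>Analyticity of \<Theta> at z^N cannot be read off through a local inverse of the power,
  which is missing at 0 when N > 1. Instead, a nicely meromorphic function is analytic wherever it
  has no pole, and a pole at z^N would produce one of the composed function at z.\<close>

lemma analyticity_domain_power:
  assumes nm: "\<And>i j. (\<lambda>z. \<Theta> z $ i $ j) nicely_meromorphic_on ball 0 1" and N: "0 < N"
  shows "analyticity_domain (\<lambda>z. \<Theta> (z ^ N)) = {z. z ^ N \<in> analyticity_domain \<Theta>}"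
proof -
  have ball: "z ^ N \<in> ball 0 1 \<longleftrightarrow> z \<in> ball 0 1" for z :: complex
    using N by (simp add: norm_power power_less_one_iff)
  have "(\<lambda>w. \<Theta> (w ^ N) $ i $ j) analytic_on {z} \<longleftrightarrow> (\<lambda>w. \<Theta> w $ i $ j) analytic_on {z ^ N}"
    if z: "z \<in> ball 0 1" for z i j
  proof
    assume an: "(\<lambda>w. \<Theta> w $ i $ j) analytic_on {z ^ N}"
    have "(\<lambda>w. w ^ N) analytic_on {z}" by (intro analytic_intros)
    from analytic_on_compose[OF this, of "\<lambda>w. \<Theta> w $ i $ j"] an
    show "(\<lambda>w. \<Theta> (w ^ N) $ i $ j) analytic_on {z}" by (simp add: o_def)
  next
    assume "(\<lambda>w. \<Theta> (w ^ N) $ i $ j) analytic_on {z}"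
    then have "\<not> is_pole (\<lambda>w. \<Theta> (w ^ N) $ i $ j) z"
      by (intro not_is_pole_holomorphic analytic_at_imp_no_pole)
    then have "\<not> is_pole (\<lambda>w. \<Theta> w $ i $ j) (z ^ N)"
      using is_pole_power[OF _ N] by blast
    then show "(\<lambda>w. \<Theta> w $ i $ j) analytic_on {z ^ N}"
      using nicely_meromorphic_on_imp_analytic_at[OF nm] ball z by blast
  qed
  then show ?thesis unfolding analyticity_domain_def using ball by blast
qed

text \<open>The numerators of the two kernels coincide; only the denominators 1 - x and 1 - x^N
  differ, where x is the product of z and \<open>cnj w\<close>, and their quotient is the geometric
  sum.\<close>

lemma schur_kernel_power:
  assumes "cmod z < 1" "cmod w < 1" "0 < N"
  shows "schur_kernel J (\<lambda>z. \<Theta> (z ^ N)) z w *v \<xi> =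
    (\<Sum>j<N. z ^ j * cnj w ^ j) *s (schur_kernel J \<Theta> (z ^ N) (w ^ N) *v \<xi>)"
proof -
  define x where "x = z * cnj w"
  have "cmod x < 1"
    unfolding x_def norm_mult complex_mod_cnj
    using mult_strict_mono'[OF assms(1,2)] by simp
  then have x1: "1 - x \<noteq> 0" and "cmod (x ^ N) < 1"
    using assms(3) by (auto simp: norm_power power_less_one_iff)
  then have xN: "1 - x ^ N \<noteq> 0" by auto
  have "1 - x ^ N = (1 - x) * (\<Sum>j<N. x ^ j)" by (rule one_diff_power_eq)
  moreover from this have "(\<Sum>j<N. x ^ j) \<noteq> 0" using xN by auto
  ultimately have frac: "a / (1 - x) = (\<Sum>j<N. x ^ j) * (a / (1 - x ^ N))" for a
    using x1 by simp
  have "schur_kernel J (\<lambda>z. \<Theta> (z ^ N)) z w $ i $ k =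
      (\<Sum>j<N. x ^ j) * schur_kernel J \<Theta> (z ^ N) (w ^ N) $ i $ k" for i k
    using frac by (simp add: schur_kernel_def x_def power_mult_distrib)
  then show ?thesis
    by (simp add: Finite_Cartesian_Product.vec_eq_iff matrix_vector_mult_def sum_distrib_left
        x_def power_mult_distrib mult.assoc)
qed

text \<open>A polynomial of degree at most N - 1 cannot vanish at N points unless it is zero, and v
  \<noteq> 0 has N distinct roots.\<close>

lemma roots_determine_coefficients:
  fixes c :: "nat \<Rightarrow> complex"
  assumes v: "v \<noteq> 0" and zero: "\<And>z. z ^ N = v \<Longrightarrow> (\<Sum>j<N. z ^ j * c j) = 0" and j: "j < N"
  shows "c j = 0"
proof (rule ccontr)
  assume "c j \<noteq> 0"
  then have r: "finite {z. (\<Sum>i\<le>N - 1. c i * z ^ i) = 0} \<and>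
      card {z. (\<Sum>i\<le>N - 1. c i * z ^ i) = 0} \<le> N - 1"
    using j by (intro Poly_Roots.polyfun_rootbound) (auto intro!: exI[of _ j])
  have "{z. z ^ N = v} \<subseteq> {z. (\<Sum>i\<le>N - 1. c i * z ^ i) = 0}"
  proof safe
    fix z assume "v = z ^ N"
    moreover have "{..N - 1} = {..<N}" using j by auto
    ultimately show "(\<Sum>i\<le>N - 1. c i * z ^ i) = 0"
      using zero[of z] by (simp add: mult.commute)
  qed
  with r have "card {z. z ^ N = v} \<le> N - 1" using card_mono order_trans by blast
  then show False using card_nth_roots[OF v, of N] j by simp
qed

definition power_sum :: "nat \<Rightarrow> (nat \<Rightarrow> complex \<Rightarrow> complex^'p) \<Rightarrow> complex \<Rightarrow> complex^'p" where
  "power_sum N g = (\<lambda>z. \<Sum>j<N. z ^ j *s g j (z ^ N))"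

lemma power_sum_nth: "power_sum N g z $ i = (\<Sum>j<N. z ^ j * (g j (z ^ N) $ i))"
  by (simp add: power_sum_def)

lemma power_sum_add: "power_sum N (\<lambda>j. g j + g' j) = power_sum N g + power_sum N g'"
  by (simp add: power_sum_nth fun_eq_iff Finite_Cartesian_Product.vec_eq_iff distrib_left sum.distrib)

lemma power_sum_scale: "power_sum N (\<lambda>j. vfun_scale c (g j)) = vfun_scale c (power_sum N g)"
  by (simp add: power_sum_nth vfun_scale_def fun_eq_iff Finite_Cartesian_Product.vec_eq_iff
      sum_distrib_left mult.left_commute)

lemma power_sum_zero: "power_sum N (\<lambda>j. 0) = 0"
  by (simp add: power_sum_nth fun_eq_iff Finite_Cartesian_Product.vec_eq_iff)

lemma power_sum_cong: "(\<And>j. j < N \<Longrightarrow> g j = g' j) \<Longrightarrow> power_sum N g = power_sum N g'"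
  by (simp add: power_sum_def)

lemma sum_fun_apply: "(\<Sum>i\<in>A. f i) x = (\<Sum>i\<in>A. f i x)"
  by (induction A rule: infinite_finite_induct) auto

lemma power_sum_S_op: "power_sum N g = (\<Sum>j<N. S_op N j (g j))"
  by (rule ext) (simp add: power_sum_def S_op_def sum_fun_apply)

lemma S_op_power_sum:
  assumes "j < N"
  shows "S_op N j f = power_sum N (\<lambda>k. if k = j then f else 0)"
proof -
  have "(\<Sum>k<N. S_op N k (if k = j then f else 0)) = (\<Sum>k<N. if k = j then S_op N j f else 0)"
    by (rule sum.cong) (auto simp: S_op_def)
  then show ?thesis using assms unfolding power_sum_S_op by simp
qed

text \<open>What the orthogonal sum requires of \<Theta>, isolated from Schur functions. The
  assumption \<open>at_zero\<close> is the trace of continuity at 0 that suffices to recover the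
  components there.\<close>

locale power_substitution = rk_majorant V B I h \<Omega> K
  for V :: "(complex \<Rightarrow> complex^'p) set" and B and I :: "'i set" and h \<Omega> K +
  fixes N :: nat and \<Omega>N KN
  assumes N_pos: "0 < N"
    and at_zero: "f \<in> V \<Longrightarrow> 0 \<in> \<Omega> \<Longrightarrow> (\<And>z. z \<in> \<Omega> \<Longrightarrow> z \<noteq> 0 \<Longrightarrow> f z = 0) \<Longrightarrow> f 0 = 0"
    and \<Omega>N: "\<Omega>N = {z. z ^ N \<in> \<Omega>}"
    and KN: "z \<in> \<Omega>N \<Longrightarrow> w \<in> \<Omega>N \<Longrightarrow>
      KN z w *v \<xi> = (\<Sum>j<N. z ^ j * cnj w ^ j) *s (K (z ^ N) (w ^ N) *v \<xi>)"
begin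

definition W :: "(complex \<Rightarrow> complex^'p) set" where
  "W = power_sum N ` ({..<N} \<rightarrow> V)"

text \<open>Only the values at \<open>j < N\<close> are determined by \<open>f\<close>, and only for \<open>f \<in> W\<close>.\<close>

definition co :: "(complex \<Rightarrow> complex^'p) \<Rightarrow> nat \<Rightarrow> complex \<Rightarrow> complex^'p" where
  "co f = (SOME g. g \<in> {..<N} \<rightarrow> V \<and> f = power_sum N g)"

definition BW :: "(complex \<Rightarrow> complex^'p) \<Rightarrow> (complex \<Rightarrow> complex^'p) \<Rightarrow> complex" where
  "BW f g = (\<Sum>j<N. B (co f j) (co g j))"

text \<open>Each vector \<open>h i\<close> placed into each of the N summands, as the negative part
  of an orthogonal sum is the sum of the negative parts.\<close>

definition hW :: "nat \<times> 'i \<Rightarrow> complex \<Rightarrow> complex^'p" where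
  "hW = (\<lambda>(j, i). S_op N j (h i))"

text \<open>At z \<noteq> 0 the values of the sum at all N-th roots of z determine the components.
  At 0 the difference of two candidates falls under \<open>at_zero\<close>, and outside \<Omega>
  both vanish.\<close>

lemma power_sum_inj:
  assumes g: "g \<in> {..<N} \<rightarrow> V" and g': "g' \<in> {..<N} \<rightarrow> V"
    and eq: "power_sum N g = power_sum N g'" and j: "j < N"
  shows "g j = g' j"
proof -
  have V: "g j \<in> V" "g' j \<in> V" using g g' j by auto
  have nonzero: "g j z = g' j z" if "z \<noteq> 0" for z
  proof -
    have "g j z $ i - g' j z $ i = 0" for i
    proof (rule roots_determine_coefficients[OF that _ j, of "\<lambda>j. g j z $ i - g' j z $ i"])
      fix u assume "u ^ N = z"
      then show "(\<Sum>j<N. u ^ j * (g j z $ i - g' j z $ i)) = 0"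
        using power_sum_nth[of N g u i] power_sum_nth[of N g' u i] eq
        by (simp add: right_diff_distrib sum_subtractf)
    qed
    then show ?thesis by (simp add: Finite_Cartesian_Product.vec_eq_iff)
  qed
  have "g j z = g' j z" for z
  proof (cases "z \<in> \<Omega> \<and> z = 0")
    case True
    have "(g j - g' j) 0 = 0"
      by (rule at_zero[OF V_diff[OF V]]) (use True nonzero in auto)
    then show ?thesis using True by simp
  next
    case False
    then show ?thesis using nonzero vanish[OF V(1)] vanish[OF V(2)] by metis
  qed
  then show ?thesis by (rule ext)
qed

lemma power_sum_in_W: "g \<in> {..<N} \<rightarrow> V \<Longrightarrow> power_sum N g \<in> W"
  unfolding W_def by (rule imageI)

lemma co_props:
  assumes "f \<in> W"
  shows "co f \<in> {..<N} \<rightarrow> V" "power_sum N (co f) = f"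
proof -
  have "\<exists>g. g \<in> {..<N} \<rightarrow> V \<and> f = power_sum N g" using assms unfolding W_def by blast
  from someI_ex[OF this] show "co f \<in> {..<N} \<rightarrow> V" "power_sum N (co f) = f"
    unfolding co_def by auto
qed

lemma co_V: "f \<in> W \<Longrightarrow> j < N \<Longrightarrow> co f j \<in> V"
  using co_props(1) by auto

lemma co_power_sum:
  assumes "g \<in> {..<N} \<rightarrow> V" "j < N"
  shows "co (power_sum N g) j = g j"
  by (rule power_sum_inj[OF co_props(1)[OF power_sum_in_W[OF assms(1)]] assms(1)
        co_props(2)[OF power_sum_in_W[OF assms(1)]] assms(2)])

lemma S_op_in_W: "f \<in> V \<Longrightarrow> j < N \<Longrightarrow> S_op N j f \<in> W"
  by (simp add: S_op_power_sum power_sum_in_W V_zero)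

lemma co_S_op: "f \<in> V \<Longrightarrow> j < N \<Longrightarrow> k < N \<Longrightarrow> co (S_op N j f) k = (if k = j then f else 0)"
  by (simp add: S_op_power_sum co_power_sum V_zero)

lemma W_add:
  assumes "f \<in> W" "g \<in> W"
  shows "f + g \<in> W" and "j < N \<Longrightarrow> co (f + g) j = co f j + co g j"
proof -
  have eq: "f + g = power_sum N (\<lambda>j. co f j + co g j)"
    unfolding power_sum_add by (simp only: co_props assms)
  have V: "(\<lambda>j. co f j + co g j) \<in> {..<N} \<rightarrow> V" using co_V assms by (auto intro!: V_add)
  show "f + g \<in> W" unfolding eq by (rule power_sum_in_W[OF V])
  show "j < N \<Longrightarrow> co (f + g) j = co f j + co g j" unfolding eq by (rule co_power_sum[OF V])
qed

lemma W_scale: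
  assumes "f \<in> W"
  shows "vfun_scale c f \<in> W" and "j < N \<Longrightarrow> co (vfun_scale c f) j = vfun_scale c (co f j)"
proof -
  have eq: "vfun_scale c f = power_sum N (\<lambda>j. vfun_scale c (co f j))"
    unfolding power_sum_scale by (simp only: co_props assms)
  have V: "(\<lambda>j. vfun_scale c (co f j)) \<in> {..<N} \<rightarrow> V" using co_V assms by (auto intro!: V_scale)
  show "vfun_scale c f \<in> W" unfolding eq by (rule power_sum_in_W[OF V])
  show "j < N \<Longrightarrow> co (vfun_scale c f) j = vfun_scale c (co f j)"
    unfolding eq by (rule co_power_sum[OF V])
qed

lemma W_zero: "0 \<in> W"
  using power_sum_in_W[of "\<lambda>j. 0"] by (simp only: power_sum_zero) (simp add: V_zero)

lemma subspace_W: "vfun.subspace W"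
  unfolding vfun.subspace_def using W_zero W_add(1) W_scale(1) by blast

lemma co_diff:
  assumes "f \<in> W" "g \<in> W" "j < N"
  shows "co (f - g) j = co f j - co g j"
  using W_add(2)[OF vfun.subspace_diff[OF subspace_W assms(1,2)] assms(2,3)]
  by (simp only: diff_add_cancel eq_diff_eq)

text \<open>A function placed into one summand pairs with that component alone. This is already the
  adjoint formula: taking the component j is adjoint to \<open>S_op N j\<close>.\<close>

lemma BW_S_op:
  assumes "f \<in> W" "g \<in> V" "j < N"
  shows "BW f (S_op N j g) = B (co f j) g" "BW (S_op N j g) f = B g (co f j)"
proof -
  have "BW f (S_op N j g) = (\<Sum>k<N. if k = j then B (co f j) g else 0)"
    unfolding BW_def using assms co_V by (intro sum.cong) (auto simp: co_S_op zero_right)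
  then show "BW f (S_op N j g) = B (co f j) g" using assms by simp
  have "BW (S_op N j g) f = (\<Sum>k<N. if k = j then B g (co f j) else 0)"
    unfolding BW_def using assms co_V by (intro sum.cong) (auto simp: co_S_op zero_left)
  then show "BW (S_op N j g) f = B g (co f j)" using assms by simp
qed

lemma hermitian_BW: "vfun.hermitian_form W BW"
  unfolding vfun.hermitian_form_def
proof (intro conjI ballI allI)
  fix x y z assume "x \<in> W" "y \<in> W" "z \<in> W"
  then show "BW (x + y) z = BW x z + BW y z"
    unfolding BW_def sum.distrib[symmetric]
    by (intro sum.cong) (simp_all only: lessThan_iff W_add co_V add_left)
next
  fix c x y assume "x \<in> W" "y \<in> W"
  then show "BW (vfun_scale c x) y = c * BW x y"
    unfolding BW_def sum_distrib_left
    by (intro sum.cong) (simp_all only: lessThan_iff W_scale co_V scale_left)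
next
  fix x y assume "x \<in> W" "y \<in> W"
  then show "BW y x = cnj (BW x y)"
    unfolding BW_def cnj_sum by (intro sum.cong refl sym co_V) auto
qed

lemma hW_in: "p \<in> {..<N} \<times> I \<Longrightarrow> hW p \<in> W"
  by (auto simp: hW_def intro!: S_op_in_W h_in)

text \<open>Since \<open>hW (j, i)\<close> sees only component j, the majorant is that of a Hilbert
  space sum; its norm is the Euclidean combination of the component norms.\<close>

lemma sum_hW:
  assumes "f \<in> W" "g \<in> W"
  shows "majorant BW ({..<N} \<times> I) hW f g = (\<Sum>j<N. majorant B I h (co f j) (co g j))"
proof -
  have "(\<Sum>p\<in>{..<N} \<times> I. BW f (hW p) * BW (hW p) g) =
      (\<Sum>j<N. \<Sum>i\<in>I. B (co f j) (h i) * B (h i) (co g j))"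
    unfolding sum.cartesian_product
    by (intro sum.cong) (auto simp: hW_def BW_S_op assms h_in)
  then show ?thesis by (simp add: majorant_def BW_def sum.distrib sum_distrib_left)
qed

sublocale W: hermitian_space vfun_scale W BW
  by unfold_locales (rule subspace_W hermitian_BW)+

sublocale WG: inner_space vfun_scale W "majorant BW ({..<N} \<times> I) hW"
proof
  show "vfun.hermitian_form W (majorant BW ({..<N} \<times> I) hW)"
    by (rule W.hermitian_majorant[OF hW_in])
  fix f assume f: "f \<in> W" "f \<noteq> 0"
  have "\<exists>j<N. co f j \<noteq> 0"
  proof (rule ccontr)
    assume "\<not> ?thesis"
    then have "power_sum N (co f) = power_sum N (\<lambda>j. 0)" by (intro power_sum_cong) auto
    then show False using f co_props[OF f(1)] power_sum_zero by metis
  qed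
  then obtain j where j: "j < N" "co f j \<noteq> 0" by blast
  have "0 < (\<Sum>j<N. Re (majorant B I h (co f j) (co f j)))"
    using j G.pos[OF co_V[OF f(1)]] G.Re_nonneg[OF co_V[OF f(1)]]
    by (intro sum_pos2[of _ j]) auto
  then show "0 < Re (majorant BW ({..<N} \<times> I) hW f f)" using f by (simp add: sum_hW)
qed (rule subspace_W)

lemma nrm_W: "f \<in> W \<Longrightarrow> WG.nrm f = L2_set (\<lambda>j. nrm (co f j)) {..<N}"
  unfolding WG.nrm_def L2_set_def by (simp add: sum_hW G.nrm_sq co_V)

lemma W_complete: "complete_inner_space vfun_scale W (majorant BW ({..<N} \<times> I) hW)"
proof
  fix X :: "nat \<Rightarrow> complex \<Rightarrow> complex^'p"
  assume X: "\<And>n. X n \<in> W" and Cau: "\<And>e. 0 < e \<Longrightarrow> \<exists>M. \<forall>m\<ge>M. \<forall>n\<ge>M. WG.nrm (X m - X n) < e"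
  have diff: "X m - X n \<in> W" for m n using X vfun.subspace_diff[OF subspace_W] by blast
  have le: "nrm (co (X m) j - co (X n) j) \<le> WG.nrm (X m - X n)" if "j < N" for m n j
    unfolding nrm_W[OF diff] co_diff[OF X X that, symmetric]
    by (rule member_le_L2_set) (use that in auto)
  have "\<exists>x\<in>V. (\<lambda>n. nrm (co (X n) j - x)) \<longlonglongrightarrow> 0" if j: "j < N" for j
  proof (rule G.complete[OF co_V[OF X j]])
    fix e :: real assume "0 < e"
    from Cau[OF this] show "\<exists>M. \<forall>m\<ge>M. \<forall>n\<ge>M. nrm (co (X m) j - co (X n) j) < e"
      using le[OF j] by (meson le_less_trans)
  qed
  then obtain x where x: "\<And>j. j < N \<Longrightarrow> x j \<in> V"
    "\<And>j. j < N \<Longrightarrow> (\<lambda>n. nrm (co (X n) j - x j)) \<longlonglongrightarrow> 0" by metis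
  have xN: "x \<in> {..<N} \<rightarrow> V" using x by auto
  let ?x = "power_sum N x"
  have xW: "?x \<in> W" by (rule power_sum_in_W[OF xN])
  have "(\<lambda>n. WG.nrm (X n - ?x)) \<longlonglongrightarrow> 0"
  proof (rule Lim_null_comparison)
    show "\<forall>\<^sub>F n in sequentially. norm (WG.nrm (X n - ?x)) \<le> (\<Sum>j<N. nrm (co (X n) j - x j))"
    proof (rule always_eventually, rule allI)
      fix n
      have d: "X n - ?x \<in> W" using X xW vfun.subspace_diff[OF subspace_W] by blast
      have "WG.nrm (X n - ?x) \<le> (\<Sum>j<N. nrm (co (X n - ?x) j))"
        unfolding nrm_W[OF d] by (rule L2_set_le_sum) (use G.nrm_nonneg co_V[OF d] in auto)
      also have "\<dots> = (\<Sum>j<N. nrm (co (X n) j - x j))"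
        by (rule sum.cong) (simp_all only: lessThan_iff co_diff[OF X xW] co_power_sum[OF xN])
      finally show "norm (WG.nrm (X n - ?x)) \<le> (\<Sum>j<N. nrm (co (X n) j - x j))"
        using WG.nrm_nonneg[OF d] by (simp only: real_norm_def abs_of_nonneg)
    qed
    show "(\<lambda>n. \<Sum>j<N. nrm (co (X n) j - x j)) \<longlonglongrightarrow> 0"
      by (rule tendsto_null_sum) (use x in auto)
  qed
  then show "\<exists>x\<in>W. (\<lambda>n. WG.nrm (X n - x)) \<longlonglongrightarrow> 0" using xW by blast
qed

text \<open>Exhibits the components of a kernel section: pairing with them is conjugate-linear,
  which turns \<open>cnj w ^ j\<close> into \<open>w ^ j\<close> and so reassembles f at w from its
  components at w^N.\<close>

lemma kernel_section_power:
  assumes w: "w \<in> \<Omega>N"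
  shows "kernel_section \<Omega>N KN w \<xi> =
    power_sum N (\<lambda>j. vfun_scale (cnj w ^ j) (kernel_section \<Omega> K (w ^ N) \<xi>))"
proof
  fix z
  show "kernel_section \<Omega>N KN w \<xi> z =
    power_sum N (\<lambda>j. vfun_scale (cnj w ^ j) (kernel_section \<Omega> K (w ^ N) \<xi>)) z"
  proof (cases "z \<in> \<Omega>N")
    case True
    then show ?thesis using w
      by (simp add: kernel_section_def KN Finite_Cartesian_Product.vec_eq_iff power_sum_nth
          vfun_scale_def sum_distrib_right mult.assoc \<Omega>N)
  next
    case False
    then show ?thesis
      by (simp add: kernel_section_def power_sum_def vfun_scale_def \<Omega>N)
  qed
qed

lemma rk_majorant_W: "rk_majorant W BW ({..<N} \<times> I) hW \<Omega>N KN"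
proof -
  interpret WG: complete_inner_space vfun_scale W "majorant BW ({..<N} \<times> I) hW"
    by (rule W_complete)
  show ?thesis
  proof
    show "finite ({..<N} \<times> I)" using finite_I by simp
    show "hW p \<in> W" if "p \<in> {..<N} \<times> I" for p using that by (rule hW_in)
  next
    fix f assume f: "f \<in> W"
    have "(\<Sum>p\<in>{..<N} \<times> I. (cmod (BW f (hW p)))\<^sup>2) = (\<Sum>j<N. \<Sum>i\<in>I. (cmod (B (co f j) (h i)))\<^sup>2)"
      unfolding sum.cartesian_product
      by (intro sum.cong) (auto simp: hW_def BW_S_op f h_in)
    also have "\<dots> \<le> (\<Sum>j<N. Re (majorant B I h (co f j) (co f j)))"
      using co_V[OF f] by (intro sum_mono sum_le) auto
    finally show "(\<Sum>p\<in>{..<N} \<times> I. (cmod (BW f (hW p)))\<^sup>2) \<le> Re (majorant BW ({..<N} \<times> I) hW f f)"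
      using f by (simp add: sum_hW)
  next
    fix f z assume f: "f \<in> W" and z: "z \<notin> \<Omega>N"
    have "co f j (z ^ N) = 0" if "j < N" for j
      by (rule vanish[OF co_V[OF f that]]) (use z \<Omega>N in simp)
    then have "power_sum N (co f) z = 0" by (simp add: power_sum_def)
    then show "f z = 0" by (simp only: co_props[OF f])
  next
    fix w \<xi> assume w: "w \<in> \<Omega>N"
    then have wN: "w ^ N \<in> \<Omega>" by (simp add: \<Omega>N)
    let ?k = "kernel_section \<Omega> K (w ^ N) \<xi>"
    have kV: "?k \<in> V" by (rule section_in[OF wN])
    have kN: "(\<lambda>j. vfun_scale (cnj w ^ j) ?k) \<in> {..<N} \<rightarrow> V" using kV by (auto intro: V_scale)
    show "kernel_section \<Omega>N KN w \<xi> \<in> W"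
      unfolding kernel_section_power[OF w] by (rule power_sum_in_W[OF kN])
    fix f assume f: "f \<in> W"
    have "BW f (kernel_section \<Omega>N KN w \<xi>) = (\<Sum>j<N. B (co f j) (vfun_scale (cnj w ^ j) ?k))"
      unfolding BW_def kernel_section_power[OF w]
      by (rule sum.cong) (simp_all only: lessThan_iff co_power_sum[OF kN])
    also have "\<dots> = (\<Sum>j<N. w ^ j * (\<Sum>i\<in>UNIV. cnj (\<xi> $ i) * co f j (w ^ N) $ i))"
    proof (rule sum.cong)
      fix j assume "j \<in> {..<N}"
      then have "co f j \<in> V" using co_V[OF f] by simp
      then show "B (co f j) (vfun_scale (cnj w ^ j) ?k) =
          w ^ j * (\<Sum>i\<in>UNIV. cnj (\<xi> $ i) * co f j (w ^ N) $ i)"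
        by (simp only: scale_right[OF kV] reproducing[OF _ wN] complex_cnj_power complex_cnj_cnj)
    qed simp
    also have "\<dots> = (\<Sum>i\<in>UNIV. \<Sum>j<N. cnj (\<xi> $ i) * (w ^ j * co f j (w ^ N) $ i))"
      unfolding sum_distrib_left by (subst sum.swap) (simp only: mult.left_commute)
    also have "\<dots> = (\<Sum>i\<in>UNIV. cnj (\<xi> $ i) * power_sum N (co f) w $ i)"
      unfolding power_sum_nth sum_distrib_left ..
    finally show "BW f (kernel_section \<Omega>N KN w \<xi>) = (\<Sum>i\<in>UNIV. cnj (\<xi> $ i) * f w $ i)"
      by (simp only: co_props[OF f])
  qed
qed

end

section \<open>Spaces of generalized Schur functions\<close>

lemma rk_pontryagin_space_majorant:
  assumes "rk_pontryagin_space \<Omega> K V B"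
  obtains Vp Vm and I and h :: "nat \<Rightarrow> complex \<Rightarrow> complex^'p"
  where "vfun.fundamental_decomposition V B Vp Vm" "rk_majorant V B I h \<Omega> K"
    "\<And>x. x \<in> V \<Longrightarrow> vfun.decomposition_norm B Vp Vm x = sqrt (Re (majorant B I h x x))"
proof -
  from assms obtain \<kappa> where "vfun.pontryagin_space \<kappa> V B"
    and vanish: "\<And>f z. f \<in> V \<Longrightarrow> z \<notin> \<Omega> \<Longrightarrow> f z = 0"
    and rk: "\<And>w \<xi>. w \<in> \<Omega> \<Longrightarrow> kernel_section \<Omega> K w \<xi> \<in> V"
      "\<And>f w \<xi>. f \<in> V \<Longrightarrow> w \<in> \<Omega> \<Longrightarrow>
        B f (kernel_section \<Omega> K w \<xi>) = (\<Sum>i\<in>UNIV. cnj (\<xi> $ i) * f w $ i)"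
    unfolding rk_pontryagin_space_def by blast
  then obtain Vp Vm b where sub: "vfun.subspace V" "vfun.hermitian_form V B"
    and fd: "vfun.fundamental_decomposition V B Vp Vm"
    and b: "finite b" "vfun.span b = Vm"
    unfolding vfun.pontryagin_space_def by blast
  from vfun.fundamental_decomposition_finite_majorant[OF sub fd b]
  obtain I and h :: "nat \<Rightarrow> complex \<Rightarrow> complex^'p" where fm: "finite_majorant vfun_scale V B I h"
    and norm: "\<forall>x\<in>V. vfun.decomposition_norm B Vp Vm x = sqrt (Re (majorant B I h x x))"
    by (elim exE conjE)
  interpret finite_majorant vfun_scale V B I h by (rule fm)
  have "rk_majorant V B I h \<Omega> K" by unfold_locales (fact vanish rk)+
  then show ?thesis using that[OF fd] norm by blast
qed

text \<open>Openness turns the limit at 0 within the domain into a full limit at 0, where limits are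
  unique.\<close>

lemma open_analyticity_domain: "open (analyticity_domain \<Theta>)"
proof -
  have "open {z. f analytic_on {z}}" for f :: "complex \<Rightarrow> complex"
    unfolding open_subopen[of "{z. f analytic_on {z}}"]
  proof safe
    fix z assume "f analytic_on {z}"
    then obtain s where s: "open s" "z \<in> s" "f holomorphic_on s" unfolding analytic_at by blast
    then show "\<exists>T. open T \<and> z \<in> T \<and> T \<subseteq> {z. f analytic_on {z}}"
      by (intro exI[of _ s]) (auto simp: analytic_at)
  qed
  then have "open (ball 0 1 \<inter> (\<Inter>i. \<Inter>j. {z. (\<lambda>w. \<Theta> w $ i $ j) analytic_on {z}}))"
    by (intro open_Int open_INT) auto
  also have "\<dots> = analyticity_domain \<Theta>" unfolding analyticity_domain_def by blast
  finally show ?thesis .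
qed

lemma tendsto_analyticity_domain:
  assumes "z \<in> analyticity_domain \<Theta>"
  shows "\<Theta> \<midarrow>z\<rightarrow> \<Theta> z"
proof (intro vec_tendstoI)
  fix i j
  have "(\<lambda>w. \<Theta> w $ i $ j) analytic_on {z}" using assms by (simp add: analyticity_domain_def)
  then show "(\<lambda>w. \<Theta> w $ i $ j) \<midarrow>z\<rightarrow> \<Theta> z $ i $ j"
    using analytic_at_imp_isCont isContD by blast
qed

lemma tendsto_schur_kernel:
  assumes "(a \<longlongrightarrow> a0) F" "(b \<longlongrightarrow> b0) F"
    "((\<lambda>x. \<Theta> (a x)) \<longlongrightarrow> \<Theta> a0) F" "((\<lambda>x. \<Theta> (b x)) \<longlongrightarrow> \<Theta> b0) F"
    and "a0 * cnj b0 \<noteq> 1"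
  shows "((\<lambda>x. (schur_kernel J \<Theta> (a x) (b x) *v \<xi>) $ i) \<longlongrightarrow> (schur_kernel J \<Theta> a0 b0 *v \<xi>) $ i) F"
  unfolding schur_kernel_def matrix_vector_mult_def matrix_matrix_mult_def conj_transpose_def
  by (simp, intro tendsto_intros assms) (use assms(5) in auto)

text \<open>This is \<open>at_zero\<close> for Schur kernels. In each of the three limits needed for
  continuity at 0 the first argument tends to 0, so the denominator tends to 1 and only continuity
  of \<Theta> at 0 matters.\<close>

lemma rk_schur_kernel_zero:
  assumes "rk_majorant V B I h (analyticity_domain \<Theta>) (schur_kernel J \<Theta>)"
    and f: "f \<in> V" and zero: "0 \<in> analyticity_domain \<Theta>"
    and van: "\<And>z. z \<in> analyticity_domain \<Theta> \<Longrightarrow> z \<noteq> 0 \<Longrightarrow> f z = 0"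
  shows "f 0 = 0"
proof -
  interpret rk_majorant V B I h "analyticity_domain \<Theta>" "schur_kernel J \<Theta>" by fact
  let ?F = "at 0 within analyticity_domain \<Theta>"
  have F: "?F = at 0" using zero open_analyticity_domain by (rule at_within_open)
  have \<Theta>0: "(\<Theta> \<longlongrightarrow> \<Theta> 0) ?F" unfolding F using zero by (rule tendsto_analyticity_domain)
  have "f 0 $ i = 0" for i
  proof -
    have "((\<lambda>w. f w $ i) \<longlongrightarrow> f 0 $ i) ?F"
      by (rule continuous_at_point[OF zero _ _ _ f])
        (intro tendsto_schur_kernel tendsto_const tendsto_ident_at \<Theta>0; simp)+
    moreover have "\<forall>\<^sub>F w in ?F. f w $ i = 0"
      using van by (auto simp: eventually_at_filter)
    then have "((\<lambda>w. f w $ i) \<longlongrightarrow> 0) ?F" by (rule tendsto_eventually)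
    ultimately show ?thesis unfolding F by (rule LIM_unique)
  qed
  then show ?thesis by (simp add: Finite_Cartesian_Product.vec_eq_iff)
qed

lemma S_op_add: "S_op N j (f + g) = S_op N j f + S_op N j g"
  by (rule ext) (simp add: S_op_def vector_add_ldistrib)

lemma S_op_scale: "S_op N j (vfun_scale c f) = vfun_scale c (S_op N j f)"
  by (rule ext) (simp add: S_op_def vfun_scale_def vector_smult_assoc mult.commute)

theorem theorem5p3:
  fixes J :: "complex^'p^'p"
    and \<kappa> N :: nat
    and \<Theta> \<Theta>\<^sub>N :: "complex \<Rightarrow> complex^'p^'p"
    and P P\<^sub>N :: "(complex \<Rightarrow> complex^'p) set"
    and B B\<^sub>N :: "(complex \<Rightarrow> complex^'p) \<Rightarrow> (complex \<Rightarrow> complex^'p) \<Rightarrow> complex"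
    and S S_adj :: "nat \<Rightarrow> (complex \<Rightarrow> complex^'p) \<Rightarrow> (complex \<Rightarrow> complex^'p)"
  assumes "signature_matrix J"
    and "\<Theta> \<in> gen_schur_class \<kappa> J"
    and "N \<ge> 1"
    and "\<Theta>\<^sub>N = (\<lambda>z. \<Theta> (z ^ N))"
    and "is_P_space J \<Theta> P B"
    and "is_P_space J \<Theta>\<^sub>N P\<^sub>N B\<^sub>N"
    and "S = S_op N"
    and "S_adj = (\<lambda>j. vfun.krein_adjoint P B P\<^sub>N B\<^sub>N (S j))"
  shows "(\<forall>j<N. vfun.bounded_operator P B P\<^sub>N B\<^sub>N (S j)) \<and>
         (\<forall>j<N. vfun.is_krein_adjoint P B P\<^sub>N B\<^sub>N (S j) (S_adj j)) \<and>
         (\<forall>f\<in>P\<^sub>N. \<exists>!g. g \<in> {..<N} \<rightarrow>\<^sub>E P \<and> f = (\<lambda>z. \<Sum>j<N. z ^ j *s g j (z ^ N))) \<and>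
         (\<forall>f\<in>P\<^sub>N. \<forall>g. g \<in> {..<N} \<rightarrow> P \<and> f = (\<lambda>z. \<Sum>j<N. z ^ j *s g j (z ^ N)) \<longrightarrow>
           (\<forall>j<N. S_adj j f = g j)) \<and>
         (\<forall>j<N. \<forall>k<N. \<forall>f\<in>P. S_adj j (S k f) = (if j = k then f else 0)) \<and>
         (\<forall>f\<in>P\<^sub>N. (\<Sum>j<N. S j (S_adj j f)) = f)"
proof -
  have N: "0 < N" using assms(3) by simp
  let ?\<Omega> = "analyticity_domain \<Theta>"
  obtain Vp Vm I and h :: "nat \<Rightarrow> complex \<Rightarrow> complex^'p"
    where fd: "vfun.fundamental_decomposition P B Vp Vm"
      and R: "rk_majorant P B I h ?\<Omega> (schur_kernel J \<Theta>)"
      and norm: "\<And>x. x \<in> P \<Longrightarrow> vfun.decomposition_norm B Vp Vm x = sqrt (Re (majorant B I h x x))"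
    using rk_pontryagin_space_majorant[OF assms(5)[unfolded is_P_space_def]] by blast
  obtain Wp Wm I' and h' :: "nat \<Rightarrow> complex \<Rightarrow> complex^'p"
    where fd': "vfun.fundamental_decomposition P\<^sub>N B\<^sub>N Wp Wm"
      and R': "rk_majorant P\<^sub>N B\<^sub>N I' h' (analyticity_domain \<Theta>\<^sub>N) (schur_kernel J \<Theta>\<^sub>N)"
      and norm': "\<And>x. x \<in> P\<^sub>N \<Longrightarrow>
        vfun.decomposition_norm B\<^sub>N Wp Wm x = sqrt (Re (majorant B\<^sub>N I' h' x x))"
    using rk_pontryagin_space_majorant[OF assms(6)[unfolded is_P_space_def]] by blast
  interpret r: rk_majorant P B I h ?\<Omega> "schur_kernel J \<Theta>" by (rule R)
  interpret r': rk_majorant P\<^sub>N B\<^sub>N I' h' "analyticity_domain \<Theta>\<^sub>N" "schur_kernel J \<Theta>\<^sub>N" by (rule R')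
  interpret power_substitution P B I h ?\<Omega> "schur_kernel J \<Theta>" N
    "analyticity_domain \<Theta>\<^sub>N" "schur_kernel J \<Theta>\<^sub>N"
  proof
    show "0 < N" by (rule N)
    show "f 0 = 0" if "f \<in> P" "0 \<in> ?\<Omega>" "\<And>z. z \<in> ?\<Omega> \<Longrightarrow> z \<noteq> 0 \<Longrightarrow> f z = 0" for f
      using rk_schur_kernel_zero[OF R that] .
    show "analyticity_domain \<Theta>\<^sub>N = {z. z ^ N \<in> ?\<Omega>}"
      unfolding assms(4) using assms(2) N
      by (intro analyticity_domain_power) (auto simp: gen_schur_class_def)
    show "schur_kernel J \<Theta>\<^sub>N z w *v \<xi> =
        (\<Sum>j<N. z ^ j * cnj w ^ j) *s (schur_kernel J \<Theta> (z ^ N) (w ^ N) *v \<xi>)"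
      if "z \<in> analyticity_domain \<Theta>\<^sub>N" "w \<in> analyticity_domain \<Theta>\<^sub>N" for z w \<xi>
      unfolding assms(4) using that N
      by (intro schur_kernel_power) (auto simp: analyticity_domain_def)
  qed
  \<comment> \<open>From here on every element of \<open>P\<^sub>N\<close> has components
    \<open>co f j\<close> in P.\<close>
  have W: "W = P\<^sub>N" using rk_majorant_unique(1)[OF rk_majorant_W R'] .
  have BW: "B\<^sub>N f g = BW f g" if "f \<in> P\<^sub>N" "g \<in> P\<^sub>N" for f g
    using rk_majorant_unique(2)[OF rk_majorant_W R'] that by (simp only: W)
  have S_in: "S j f \<in> P\<^sub>N" if "j < N" "f \<in> P" for j f
    using S_op_in_W that by (simp only: W assms(7))
  have form: "B\<^sub>N (S j f) g = B f (co g j)" if "j < N" "f \<in> P" "g \<in> P\<^sub>N" for j f g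
    unfolding BW[OF S_in[OF that(1,2)] that(3)] unfolding assms(7)
    by (rule BW_S_op(2)) (use that W in auto)
  have co_in: "co f j \<in> P" if "f \<in> P\<^sub>N" "j < N" for f j
    using co_V that by (simp only: W)
  have adj: "S_adj j f = co f j" if "j < N" "f \<in> P\<^sub>N" for j f
    unfolding assms(8) vfun.krein_adjoint_def
  proof (rule the_equality)
    show "co f j \<in> P \<and> (\<forall>f1\<in>P. B\<^sub>N (S j f1) f = B f1 (co f j))"
      using co_in form that by blast
    show "g = co f j" if "g \<in> P \<and> (\<forall>f1\<in>P. B\<^sub>N (S j f1) f = B f1 g)" for g
      using that co_in[OF \<open>f \<in> P\<^sub>N\<close> \<open>j < N\<close>] form[OF \<open>j < N\<close> _ \<open>f \<in> P\<^sub>N\<close>]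
      by (intro r.form_nondegenerate) auto
  qed
  have bounded: "vfun.bounded_operator P B P\<^sub>N B\<^sub>N (S j)" if j: "j < N" for j
  proof -
    \<comment> \<open>The norm on \<open>P\<^sub>N\<close> belongs to some decomposition unrelated
      to the orthogonal sum, so \<open>S j\<close> need not be isometric for it. The first term
      bounds [S_j x, S_j x] = [x, x]; the others bound the pairings with \<open>h' i\<close>, which
      equal pairings of x with the components of \<open>h' i\<close>.\<close>
    define C where "C = r.bnd + 2 * (\<Sum>i\<in>I'. (r.bnd * r.nrm (co (h' i) j))\<^sup>2)"
    have "0 \<le> C" unfolding C_def by (intro add_nonneg_nonneg mult_nonneg_nonneg sum_nonneg) auto
    have le: "r'.nrm (S j x) \<le> sqrt C * r.nrm x" if x: "x \<in> P" for x
    proof -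
      have "B\<^sub>N (S j x) (S j x) = B x x"
        unfolding form[OF j x S_in[OF j x]] using co_S_op[OF x j j] by (simp add: assms(7))
      then have "Re (B\<^sub>N (S j x) (S j x)) \<le> r.bnd * r.nrm x * r.nrm x"
        using r.form_bounded[OF x x] complex_Re_le_cmod[of "B x x"] by simp
      moreover have "(\<Sum>i\<in>I'. (cmod (B\<^sub>N (S j x) (h' i)))\<^sup>2) \<le>
          (\<Sum>i\<in>I'. (r.bnd * r.nrm (co (h' i) j))\<^sup>2 * (r.nrm x)\<^sup>2)"
      proof (rule sum_mono)
        fix i assume i: "i \<in> I'"
        have "cmod (B\<^sub>N (S j x) (h' i)) \<le> r.bnd * r.nrm x * r.nrm (co (h' i) j)"
          unfolding form[OF j x r'.h_in[OF i]]
          by (rule r.form_bounded[OF x co_in[OF r'.h_in[OF i] j]])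
        then have "(cmod (B\<^sub>N (S j x) (h' i)))\<^sup>2 \<le> (r.bnd * r.nrm x * r.nrm (co (h' i) j))\<^sup>2"
          by (intro power_mono) auto
        then show "(cmod (B\<^sub>N (S j x) (h' i)))\<^sup>2 \<le>
            (r.bnd * r.nrm (co (h' i) j))\<^sup>2 * (r.nrm x)\<^sup>2"
          by (simp add: power_mult_distrib mult_ac)
      qed
      ultimately have "(r'.nrm (S j x))\<^sup>2 \<le> r.bnd * r.nrm x * r.nrm x +
          2 * (\<Sum>i\<in>I'. (r.bnd * r.nrm (co (h' i) j))\<^sup>2 * (r.nrm x)\<^sup>2)"
        using r'.Re_majorant[OF S_in[OF j x]] by linarith
      also have "\<dots> = C * (r.nrm x)\<^sup>2"
        unfolding C_def sum_distrib_right[symmetric]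
        by (simp only: distrib_right power2_eq_square mult.assoc)
      finally have "(r'.nrm (S j x))\<^sup>2 \<le> (sqrt C * r.nrm x)\<^sup>2"
        using \<open>0 \<le> C\<close> by (simp add: power_mult_distrib)
      then show ?thesis
        using \<open>0 \<le> C\<close> r.G.nrm_nonneg[OF x] by (auto intro: power2_le_imp_le)
    qed
    have norm_le: "vfun.decomposition_norm B\<^sub>N Wp Wm (S j x) \<le>
        sqrt C * vfun.decomposition_norm B Vp Vm x" if "x \<in> P" for x
      using le[OF that] unfolding norm[OF that] norm'[OF S_in[OF j that]] r.G.nrm_def r'.G.nrm_def .
    show ?thesis
      unfolding vfun.bounded_operator_def
    proof (intro conjI)
      show "S j \<in> P \<rightarrow> P\<^sub>N" using S_in[OF j] by blast
      show "\<forall>x\<in>P. \<forall>y\<in>P. S j (x + y) = S j x + S j y"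
        unfolding assms(7) using S_op_add by blast
      show "\<forall>c. \<forall>x\<in>P. S j (vfun_scale c x) = vfun_scale c (S j x)"
        unfolding assms(7) using S_op_scale by blast
      show "\<exists>Vp Vm Wp Wm C. vfun.fundamental_decomposition P B Vp Vm \<and>
          vfun.fundamental_decomposition P\<^sub>N B\<^sub>N Wp Wm \<and>
          (\<forall>x\<in>P. vfun.decomposition_norm B\<^sub>N Wp Wm (S j x) \<le>
             C * vfun.decomposition_norm B Vp Vm x)"
        by (intro exI conjI ballI) (rule fd fd' norm_le, assumption?)+
    qed
  qed
  have sum_eq: "(\<lambda>z. \<Sum>j<N. z ^ j *s g j (z ^ N)) = power_sum N g" for g :: "nat \<Rightarrow> complex \<Rightarrow> complex^'p"
    by (simp only: power_sum_def)
  have unique: "\<exists>!g. g \<in> {..<N} \<rightarrow>\<^sub>E P \<and> f = power_sum N g" if f: "f \<in> P\<^sub>N" for f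
  proof (rule ex1I)
    have f: "f \<in> W" using f W by simp
    \<comment> \<open>Restricting fixes the values at j \<ge> N, which the sum does not see; only
      then is the family unique as a function.\<close>
    have "power_sum N (restrict (co f) {..<N}) = power_sum N (co f)" by (rule power_sum_cong) simp
    then show "restrict (co f) {..<N} \<in> {..<N} \<rightarrow>\<^sub>E P \<and> f = power_sum N (restrict (co f) {..<N})"
      using co_props[OF f] by simp
    show "g = restrict (co f) {..<N}" if "g \<in> {..<N} \<rightarrow>\<^sub>E P \<and> f = power_sum N g" for g
    proof (rule extensionalityI)
      fix j assume "j \<in> {..<N}"
      then show "g j = restrict (co f) {..<N} j"
        using that co_power_sum[of g j] by (auto simp: PiE_def)
    qed (use that in \<open>auto simp: PiE_def\<close>)
  qed
  show ?thesis
    unfolding sum_eq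
  proof (intro conjI allI impI ballI)
    show "vfun.bounded_operator P B P\<^sub>N B\<^sub>N (S j)" if "j < N" for j using that by (rule bounded)
    show "vfun.is_krein_adjoint P B P\<^sub>N B\<^sub>N (S j) (S_adj j)" if "j < N" for j
      unfolding vfun.is_krein_adjoint_def using adj[OF that] co_in form that by simp
    show "\<exists>!g. g \<in> {..<N} \<rightarrow>\<^sub>E P \<and> f = power_sum N g" if "f \<in> P\<^sub>N" for f
      using that by (rule unique)
    show "S_adj j f = g j" if "f \<in> P\<^sub>N" "g \<in> {..<N} \<rightarrow> P \<and> f = power_sum N g" "j < N" for f g j
      using adj[OF that(3,1)] co_power_sum[of g j] that by simp
    show "S_adj j (S k f) = (if j = k then f else 0)" if "j < N" "k < N" "f \<in> P" for j k f
      unfolding adj[OF that(1) S_in[OF that(2,3)]] unfolding assms(7) using co_S_op[OF that(3,2,1)] .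
    show "(\<Sum>j<N. S j (S_adj j f)) = f" if "f \<in> P\<^sub>N" for f
    proof -
      have "(\<Sum>j<N. S j (S_adj j f)) = (\<Sum>j<N. S_op N j (co f j))"
        using adj that by (intro sum.cong) (auto simp: assms(7))
      also have "\<dots> = f" unfolding power_sum_S_op[symmetric] using that W co_props by simp
      finally show ?thesis .
    qed
  qed
qed

end
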